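(* Let $A$ be a finite-dimensional $n$-Lie algebra over an algebraically closed field $\mathbf{F}$ of characteristic zero. Then $A$ is elementary if and only if every subalgebra of $A$ (including $A$ itself) is complemented.
   Context: An $n$-Lie algebra ($n\ge 2$) over a field $\mathbf{F}$ is a vector space $A$ over $\mathbf{F}$ with an $n$-ary multilinear operation $[\,,\dots,\,]$ satisfying $[x_1,\dots,x_n]=\operatorname{sgn}(\sigma)[x_{\sigma(1)},\dots,x_{\sigma(n)}]$ for all $\sigma\in S_n$ and $[[x_1,\dots,x_n],y_2,\dots,y_n]=\sum_{i=1}^n[x_1,\dots,[x_i,y_2,\dots,y_n],\dots,x_n]$. A subalgebra is a subspace $B$ with $[B,\dots,B]\subseteq B$; an ideal is a subspace $I$ with $[I,A,\dots,A]\subseteq I$. A proper subalgebra $M$ is maximal if the only subalgebra properly containing $M$ is $A$ itself. The Frattini subalgebra $F(A)$ is the intersection of all maximal subalgebras of $A$ (with $F(0)=0$), and $\Phi(A)$ is the largest ideal of $A$ contained in $F(A)$. $A$ is elementary if $\Phi(C)=0$ for every subalgebra $C$ of $A$ (including $A$ itself). An $n$-Lie algebra $L$ is complemented if its subalgebra lattice is complemented: for every subalgebra $B$ of $L$ there is a subalgebra $C$ of $L$ such that $B\cap C=0$ and the subalgebra of $L$ generated by $B$ and $C$ is $L$. A subalgebra of $A$ is called complemented if it is complemented as an $n$-Lie algebra in its own right. *)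

theory Defs
  imports
    "HOL-Computational_Algebra.Polynomial"
    "HOL-Combinatorics.Permutations"
begin

text \<open>
  The carrier \<open>A\<close> is a subspace of an ambient vector space, so that a subalgebra \<open>C\<close> is again an
  \<open>n\<close>-Lie algebra for the same bracket, and every notion below can be applied to \<open>C\<close> in its own
  right (written \<open>n_Lie_algebra.foo scale n br C\<close> outside the locale). The bracket
  \<open>[x\<^sub>1, \<dots>, x\<^sub>n]\<close> is \<open>br [x1, ..., xn]\<close>; only its values on lists of length \<open>n\<close> with entries in \<open>A\<close>
  are constrained or used. Taking \<open>A = UNIV\<close> gives the case without an ambient space.
\<close>

locale n_Lie_algebra = vector_space scale
  for scale :: "'f::field \<Rightarrow> 'v::ab_group_add \<Rightarrow> 'v" +
  fixes n :: nat
    and br :: "'v list \<Rightarrow> 'v"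
    and A :: "'v set"
  assumes n_ge_2: "n \<ge> 2"
    and subspace_carrier: "subspace A"
    and br_closed: "\<lbrakk>length xs = n; set xs \<subseteq> A\<rbrakk> \<Longrightarrow> br xs \<in> A"
    and br_add: "\<lbrakk>length xs = n; set xs \<subseteq> A; i < n; a \<in> A; b \<in> A\<rbrakk> \<Longrightarrow>
      br (xs[i := a + b]) = br (xs[i := a]) + br (xs[i := b])"
    and br_scale: "\<lbrakk>length xs = n; set xs \<subseteq> A; i < n; a \<in> A\<rbrakk> \<Longrightarrow>
      br (xs[i := scale c a]) = scale c (br (xs[i := a]))"
    and br_skew: "\<lbrakk>length xs = n; set xs \<subseteq> A; \<sigma> permutes {..<n}\<rbrakk> \<Longrightarrow>
      br xs = scale (of_int (sign \<sigma>)) (br (permute_list \<sigma> xs))"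
    and br_Jacobi: "\<lbrakk>length xs = n; set xs \<subseteq> A; length ys = n - 1; set ys \<subseteq> A\<rbrakk> \<Longrightarrow>
      br (br xs # ys) = (\<Sum>i<n. br (xs[i := br ((xs ! i) # ys)]))"
begin

definition finite_dim :: bool where
  "finite_dim \<longleftrightarrow> (\<exists>B. finite B \<and> span B = A)"

definition subalgebra :: "'v set \<Rightarrow> bool" where
  "subalgebra B \<longleftrightarrow> subspace B \<and> B \<subseteq> A \<and>
    (\<forall>xs. length xs = n \<longrightarrow> set xs \<subseteq> B \<longrightarrow> br xs \<in> B)"

definition ideal :: "'v set \<Rightarrow> bool" where
  "ideal I \<longleftrightarrow> subspace I \<and> I \<subseteq> A \<and>
    (\<forall>x ys. x \<in> I \<longrightarrow> length ys = n - 1 \<longrightarrow> set ys \<subseteq> A \<longrightarrow> br (x # ys) \<in> I)"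

definition maximal_subalgebra :: "'v set \<Rightarrow> bool" where
  "maximal_subalgebra M \<longleftrightarrow> subalgebra M \<and> M \<noteq> A \<and>
    (\<forall>B. subalgebra B \<longrightarrow> M \<subset> B \<longrightarrow> B = A)"

text \<open>Intersecting with \<open>A\<close> matters only when there is no maximal subalgebra; in particular it
  yields the convention \<open>F(0) = 0\<close>.\<close>

definition Frattini_subalgebra :: "'v set" where
  "Frattini_subalgebra = A \<inter> \<Inter>{M. maximal_subalgebra M}"

text \<open>The largest ideal inside the Frattini subalgebra, constructed as the sum of all such ideals;
  lemma \<open>Frattini_ideal_greatest\<close> below shows that it is indeed the largest one.\<close>

definition Frattini_ideal :: "'v set" where
  "Frattini_ideal = span (\<Union>{I. ideal I \<and> I \<subseteq> Frattini_subalgebra})"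

definition complemented :: bool where
  "complemented \<longleftrightarrow> (\<forall>B. subalgebra B \<longrightarrow>
    (\<exists>C. subalgebra C \<and> B \<inter> C = {0} \<and> subalgebra hull (B \<union> C) = A))"

lemma subspace_Frattini_subalgebra: "subspace Frattini_subalgebra"
  unfolding Frattini_subalgebra_def
  by (intro subspace_inter subspace_Inter subspace_carrier)
     (auto simp: maximal_subalgebra_def subalgebra_def)

lemma Frattini_ideal_subset: "Frattini_ideal \<subseteq> Frattini_subalgebra"
  unfolding Frattini_ideal_def
  by (rule span_minimal) (auto simp: subspace_Frattini_subalgebra)

lemma ideal_Frattini_ideal: "ideal Frattini_ideal"
proof -
  let ?U = "\<Union>{I. ideal I \<and> I \<subseteq> Frattini_subalgebra}"
  have sub: "span ?U \<subseteq> A"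
    using Frattini_ideal_subset by (auto simp: Frattini_ideal_def Frattini_subalgebra_def)
  have "br (x # ys) \<in> span ?U"
    if x: "x \<in> span ?U" and ys: "length ys = n - 1" "set ys \<subseteq> A" for x ys
  proof -
    have 0: "0 \<in> A"
      by (rule subspace_0[OF subspace_carrier])
    have len: "length (0 # ys) = n" "set (0 # ys) \<subseteq> A" "0 < n"
      using ys n_ge_2 0 by auto
    have add: "br ((a + b) # ys) = br (a # ys) + br (b # ys)" if "a \<in> A" "b \<in> A" for a b
      using br_add[OF len that] by simp
    have scl: "br (scale c a # ys) = scale c (br (a # ys))" if "a \<in> A" for a c
      using br_scale[OF len that] by simp
    have "x \<in> A \<and> br (x # ys) \<in> span ?U"
      using x
    proof (induction rule: span_induct_alt)
      case base
      show ?case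
        using scl[OF 0, of 0] 0 by (simp add: span_zero)
    next
      case (step c u y)
      then obtain I where I: "ideal I" "I \<subseteq> Frattini_subalgebra" "u \<in> I"
        by auto
      then have u: "u \<in> A" "br (u # ys) \<in> ?U"
        using ys by (auto simp: ideal_def)
      then have "scale c u \<in> A"
        using subspace_scale[OF subspace_carrier] by auto
      moreover have "scale c (br (u # ys)) \<in> span ?U"
        using u(2) by (intro span_scale span_base)
      ultimately show ?case
        using step u by (simp add: add scl span_add subspace_add[OF subspace_carrier])
    qed
    then show ?thesis ..
  qed
  with sub show ?thesis
    unfolding Frattini_ideal_def by (subst ideal_def) auto
qed

lemma Frattini_ideal_greatest:
  assumes "ideal I" "I \<subseteq> Frattini_subalgebra"
  shows "I \<subseteq> Frattini_ideal"
  unfolding Frattini_ideal_def using assms by (auto intro: span_base)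

lemma n_Lie_algebra_subalgebra:
  assumes "subalgebra C"
  shows "n_Lie_algebra scale n br C"
proof -
  have C: "subspace C" "C \<subseteq> A"
    and cl: "\<And>xs. length xs = n \<Longrightarrow> set xs \<subseteq> C \<Longrightarrow> br xs \<in> C"
    using assms by (auto simp: subalgebra_def)
  show ?thesis
  proof (unfold_locales, goal_cases)
    case (6 xs \<sigma>)
    then show ?case using C by (intro br_skew) auto
  next
    case (7 xs ys)
    then show ?case using C by (intro br_Jacobi) auto
  qed (use C cl n_ge_2 in \<open>auto intro!: br_add br_scale\<close>)
qed

definition elementary :: bool where
  "elementary \<longleftrightarrow> (\<forall>C. subalgebra C \<longrightarrow> n_Lie_algebra.Frattini_ideal scale n br C = {0})"

end

end

theory Submission
  imports Defs
begin

text \<open>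
  If \<open>C\<close> is complemented, then \<open>\<Phi>(C)\<close> has a complement, and
  this complement is \<open>C\<close> itself: otherwise it would lie in a maximal subalgebra, which contains
  \<open>\<Phi>(C)\<close> as well. So \<open>\<Phi>(C) = 0\<close> (\<open>Frattini_ideal_eq_0_if_complemented\<close>).

  For the converse, let \<open>B\<close> be a subalgebra of \<open>A\<close> and let \<open>C\<close> be a subalgebra of least dimension such
  that \<open>B\<close> and \<open>C\<close> generate \<open>A\<close>. Minimality forces \<open>B \<inter> C\<close> into every maximal subalgebra of \<open>C\<close>, that is,
  \<open>B \<inter> C \<subseteq> F(C)\<close> (\<open>complemented_if_Frattini_subalgebras_eq_0\<close>). It remains to pass from \<open>\<Phi>(C) = 0\<close> to
  \<open>F(C) = 0\<close>, so it is enough that over an algebraically closed field of characteristic zero the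
  Frattini subalgebra is always an ideal (\<open>ideal_Frattini_subalgebra\<close>).

  The subspace \<open>F(A)\<close> is invariant under automorphisms, and an ideal has to be invariant under the
  inner derivations \<open>T x = [x, y\<^sub>2, \<dots>, y\<^sub>n]\<close>. Over the complex numbers one would differentiate
  \<open>exp (t T)\<close> at \<open>t = 0\<close>. Over a general field the exponential is replaced as follows. The carrier is the
  direct sum of the generalised eigenspaces of \<open>T\<close>, and the Leibniz rule shows that the bracket adds
  weights (\<open>bracket_gen_eigenspace\<close>). If \<open>\<chi>\<close> takes nonzero values and turns sums of weights into products, and \<open>s\<close> is a scalar,
  then acting on the generalised eigenspace of weight \<open>l\<close> by \<open>\<chi> l\<close> times the finite exponential series
  of \<open>s (T - l)\<close> defines an automorphism (\<open>bracket_twisted_exp\<close>, \<open>twisted_exp_surj\<close>).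

  Enough characters \<open>\<chi>\<close> come from a single function \<open>h\<close> that is additive on the finitely many
  weights, injective on them and integer-valued; a generic functional over the prime field provides it
  (\<open>ex_additive_int_inj_on\<close>). With \<open>\<chi> l = (2 ^ (K h(l))) ^ t\<close> and \<open>s = 2 ^ t\<close>, where \<open>K\<close> bounds the
  nilpotency of \<open>T - l\<close> on all the generalised eigenspaces, the automorphism sends \<open>x\<close> to the sum over
  \<open>l\<close> and \<open>j < K\<close> of \<open>(2 ^ (K h(l) + j)) ^ t\<close> times the \<open>j\<close>-th divided power of \<open>T - l\<close> applied to the
  component of \<open>x\<close> of weight \<open>l\<close>. The numbers \<open>2 ^ (K h(l) + j)\<close> are distinct. So when \<open>x \<in> F(A)\<close>, a
  Vandermonde argument over all \<open>t\<close> puts each of these vectors into \<open>F(A)\<close>, and \<open>T x\<close> is a linear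
  combination of those with \<open>j \<le> 1\<close> (\<open>T_preserves_invariant_subspace\<close>).
\<close>

section \<open>Linear algebra of subspaces\<close>

context vector_space
begin

lemma finite_basis_of_subspace:
  assumes "finite B" "V \<subseteq> span B" "subspace V"
  obtains C where "finite C" "independent C" "C \<subseteq> V" "span C = V" "card C = dim V"
proof -
  obtain C where C: "C \<subseteq> V" "independent C" "V \<subseteq> span C" "card C = dim V"
    using basis_exists by blast
  moreover have "finite C"
    using independent_span_bound[OF assms(1) C(2)] C(1) assms(2) by blast
  moreover have "span C = V"
    using C assms(3) by (metis span_minimal subset_antisym)
  ultimately show ?thesis
    using that by blast
qed

lemma dim_psubset:
  assumes "finite B" "W \<subseteq> span B" "subspace V" "subspace W" "V \<subset> W"
  shows "dim V < dim W"
proof -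
  obtain C where C: "finite C" "independent C" "C \<subseteq> V" "span C = V" "card C = dim V"
    by (rule finite_basis_of_subspace[of B V]) (use assms in auto)
  obtain D where D: "finite D" "independent D" "span D = W" "card D = dim W"
    by (rule finite_basis_of_subspace[of B W]) (use assms in auto)
  obtain x where x: "x \<in> W" "x \<notin> V"
    using assms(5) by blast
  then have "independent (insert x C)" "x \<notin> C"
    using C by (auto simp: independent_insert)
  moreover have "insert x C \<subseteq> span D"
    using x C D assms(5) by auto
  ultimately have "card (insert x C) \<le> card D"
    using independent_span_bound[OF D(1)] by blast
  with \<open>x \<notin> C\<close> C D show ?thesis
    by simp
qed

text \<open>The bracket is linear only on the carrier. Extending it to the ambient space makes the
  powers of a derivation, and all polynomials in it, linear without side conditions.\<close>

lemma linear_extension: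
  assumes A: "subspace A"
    and add: "\<And>x y. x \<in> A \<Longrightarrow> y \<in> A \<Longrightarrow> f (x + y) = f x + f y"
    and scl: "\<And>c x. x \<in> A \<Longrightarrow> f (scale c x) = scale c (f x)"
  obtains T where "Vector_Spaces.linear scale scale T" "\<And>x. x \<in> A \<Longrightarrow> T x = f x"
proof -
  have pair: "vector_space_pair scale scale"
    by (rule vector_space_pair.intro[OF vector_space_axioms vector_space_axioms])
  obtain B where B: "B \<subseteq> A" "independent B" "A \<subseteq> span B"
    by (rule basis_exists[of A])
  obtain T where T: "Vector_Spaces.linear scale scale T" "\<And>x. x \<in> B \<Longrightarrow> T x = f x"
    using vector_space_pair.linear_independent_extend[OF pair B(2), of f] by blast
  have T': "T (x + y) = T x + T y" "T (scale c x) = scale c (T x)" for x y c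
    using T(1) by (simp_all add: Vector_Spaces.linear_iff)
  have T0: "T 0 = 0"
    using T'(2)[of 0 0] by simp
  have f0: "f 0 = 0"
    using scl[of 0 0] subspace_0[OF A] by simp
  have "x \<in> A \<and> T x = f x" if "x \<in> span B" for x
    using that
  proof (induction rule: span_induct_alt)
    case base
    then show ?case by (simp add: f0 T0 subspace_0[OF A])
  next
    case (step c x y)
    then show ?case
      using B T(2) A by (auto simp: T' add scl subspace_add subspace_scale)
  qed
  with B T that show ?thesis
    by blast
qed

text \<open>Vandermonde: subtracting \<open>c a\<close> times the sum for \<open>t\<close> from the sum for \<open>t + 1\<close> removes the
  term with index \<open>a\<close> and multiplies every other term by \<open>c i - c a \<noteq> 0\<close>, which gives an induction on the
  number of terms.\<close>

lemma power_sums_in_subspaceD: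
  assumes W: "subspace W" and "finite I" "inj_on c I"
    and "\<And>t::nat. (\<Sum>i\<in>I. scale (c i ^ t) (v i)) \<in> W"
    and "i \<in> I"
  shows "v i \<in> W"
  using assms(2-)
proof (induction I arbitrary: v i rule: finite_induct)
  case empty
  then show ?case by simp
next
  case (insert a I)
  have rest: "v j \<in> W" if "j \<in> I" for j
  proof -
    have "(\<Sum>i\<in>I. scale (c i ^ t) (scale (c i - c a) (v i))) \<in> W" for t
    proof -
      have "(\<Sum>i\<in>insert a I. scale (c i ^ Suc t) (v i))
          - scale (c a) (\<Sum>i\<in>insert a I. scale (c i ^ t) (v i)) \<in> W"
        by (intro subspace_diff[OF W] subspace_scale[OF W] insert.prems)
      also have "(\<Sum>i\<in>insert a I. scale (c i ^ Suc t) (v i))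
          - scale (c a) (\<Sum>i\<in>insert a I. scale (c i ^ t) (v i))
        = (\<Sum>i\<in>insert a I. scale (c i ^ t) (scale (c i - c a) (v i)))"
        unfolding scale_sum_right sum_subtractf[symmetric]
        by (intro sum.cong refl) (simp add: algebra_simps)
      finally show ?thesis
        using insert.hyps by simp
    qed
    then have "scale (c j - c a) (v j) \<in> W"
      using insert.IH[of "\<lambda>i. scale (c i - c a) (v i)"] insert.prems(1) that by simp
    then have "scale (inverse (c j - c a)) (scale (c j - c a) (v j)) \<in> W"
      by (rule subspace_scale[OF W])
    moreover have "c j \<noteq> c a"
      using insert.prems(1) insert.hyps that by (auto simp: inj_on_def)
    ultimately show ?thesis
      by simp
  qed
  have "(\<Sum>i\<in>insert a I. scale (c i ^ 0) (v i)) - (\<Sum>i\<in>I. v i) \<in> W"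
    by (intro subspace_diff[OF W] insert.prems subspace_sum[OF W] rest)
  then have "v a \<in> W"
    using insert.hyps by simp
  with rest insert.prems show ?case
    by blast
qed

end

section \<open>Integer-valued additive functions on a field\<close>

lemma ex_additive_rat_nonzero_at:
  fixes d :: "'a :: field_char_0"
  assumes "d \<noteq> 0"
  shows "\<exists>f :: 'a \<Rightarrow> rat. (\<forall>x y. f (x + y) = f x + f y) \<and> f d \<noteq> 0"
proof -
  interpret Q: vector_space "\<lambda>(q::rat) (x::'a). of_rat q * x"
    by unfold_locales (auto simp: algebra_simps of_rat_add of_rat_mult)
  have ind: "Q.independent {d}"
    using assms by simp
  let ?B = "Q.extend_basis {d}"
  have B: "Q.independent ?B" "d \<in> ?B" "Q.span ?B = UNIV"
    using Q.independent_extend_basis[OF ind] Q.extend_basis_superset[OF ind]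
      Q.span_extend_basis[OF ind] by auto
  show ?thesis
    using B by (intro exI[of _ "\<lambda>x. Q.representation ?B x d"])
      (simp add: Q.representation_add Q.representation_basis)
qed

text \<open>A rational multiple of one functional is added to another one: only finitely many
  multiples create a new zero on a finite set.\<close>

lemma ex_additive_rat_nonzero_on:
  fixes D :: "'a :: field_char_0 set"
  assumes "finite D" "0 \<notin> D"
  shows "\<exists>f :: 'a \<Rightarrow> rat. (\<forall>x y. f (x + y) = f x + f y) \<and> (\<forall>d\<in>D. f d \<noteq> 0)"
  using assms
proof (induction D rule: finite_induct)
  case empty
  show ?case by (intro exI[of _ "\<lambda>_. 0"]) simp
next
  case (insert e D)
  obtain g :: "'a \<Rightarrow> rat" where g: "\<And>x y. g (x + y) = g x + g y" "\<And>d. d \<in> D \<Longrightarrow> g d \<noteq> 0"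
    using insert by auto
  obtain h :: "'a \<Rightarrow> rat" where h: "\<And>x y. h (x + y) = h x + h y" "h e \<noteq> 0"
    using ex_additive_rat_nonzero_at[of e] insert.prems by auto
  have "finite ((\<lambda>d. - g d / h d) ` insert e D)"
    using insert.hyps by simp
  from ex_new_if_finite[OF infinite_UNIV_char_0 this]
  obtain q where q: "q \<notin> (\<lambda>d. - g d / h d) ` insert e D" ..
  have "g d + q * h d \<noteq> 0" if d: "d \<in> insert e D" for d
  proof (cases "h d = 0")
    case True
    then have "d \<in> D"
      using d h(2) by auto
    with True g(2) show ?thesis
      by simp
  next
    case False
    have "q \<noteq> - g d / h d"
      using q d by blast
    with False show ?thesis
      by (simp add: field_simps eq_neg_iff_add_eq_0 add.commute)
  qed
  then show ?case
    by (intro exI[of _ "\<lambda>x. g x + q * h x"]) (auto simp: g h algebra_simps)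
qed

lemma common_denominator:
  assumes "finite (X :: rat set)"
  shows "\<exists>N::int. N > 0 \<and> (\<forall>x\<in>X. of_int N * x \<in> \<int>)"
  using assms
proof (induction X rule: finite_induct)
  case empty
  show ?case by (intro exI[of _ 1]) simp
next
  case (insert x X)
  then obtain N where N: "N > 0" "\<And>x. x \<in> X \<Longrightarrow> of_int N * x \<in> \<int>"
    by blast
  obtain a b where ab: "quotient_of x = (a, b)"
    by fastforce
  have b: "b > 0" "x = of_int a / of_int b"
    using ab quotient_of_denom_pos quotient_of_div by auto
  have "of_int (N * b) * y \<in> \<int>" if "y \<in> insert x X" for y
  proof (cases "y = x")
    case True
    have "of_int (N * b) * x = of_int (N * a)"
      using b by simp
    with True show ?thesis by (metis Ints_of_int)
  next
    case False
    with that have "of_int b * (of_int N * y) \<in> \<int>"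
      by (intro Ints_mult N) auto
    then show ?thesis by (simp add: mult_ac)
  qed
  with N b show ?case
    by (intro exI[of _ "N * b"]) simp
qed

text \<open>A functional over the prime field \<open>\<rat>\<close> that does not vanish on the differences of elements of
  \<open>L\<close> is injective on \<open>L\<close>; clearing denominators makes it integral on \<open>L\<close>. Outside the subgroup
  generated by \<open>L\<close> its values are rounded, so additivity is asserted only for families in \<open>L\<close>.\<close>

lemma ex_additive_int_inj_on:
  fixes L :: "'a :: field_char_0 set"
  assumes L: "finite L"
  obtains h :: "'a \<Rightarrow> int" where "inj_on h L"
    and "\<And>l (m::nat). (\<And>i. i < m \<Longrightarrow> l i \<in> L) \<Longrightarrow> h (\<Sum>i<m. l i) = (\<Sum>i<m. h (l i))"
proof -
  have "finite ((\<lambda>(x, y). x - y) ` (L \<times> L) - {0})" "0 \<notin> (\<lambda>(x, y). x - y) ` (L \<times> L) - {0}"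
    using L by auto
  from ex_additive_rat_nonzero_on[OF this]
  obtain f :: "'a \<Rightarrow> rat" where f: "\<And>x y. f (x + y) = f x + f y"
    "\<And>x y. x \<in> L \<Longrightarrow> y \<in> L \<Longrightarrow> x \<noteq> y \<Longrightarrow> f (x - y) \<noteq> 0"
    by fastforce
  obtain N where N: "N > 0" "\<And>x. x \<in> L \<Longrightarrow> of_int N * f x \<in> \<int>"
    using common_denominator[of "f ` L"] L by auto
  define h where "h x = \<lfloor>of_int N * f x\<rfloor>" for x
  have hL: "of_int (h x) = of_int N * f x" if "x \<in> L" for x
    using N(2)[OF that] by (auto simp: h_def elim: Ints_cases)
  have f0: "f 0 = 0"
    using f(1)[of 0 0] by simp
  have "inj_on h L"
  proof (rule inj_onI, rule ccontr)
    fix x y assume xy: "x \<in> L" "y \<in> L" "h x = h y" "x \<noteq> y"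
    then have "f x = f y"
      using hL[of x] hL[of y] N(1) by simp
    moreover have "f (x - y) + f y = f x"
      by (simp flip: f(1))
    ultimately show False
      using f(2)[of x y] xy by simp
  qed
  moreover have "h (\<Sum>i<m. l i) = (\<Sum>i<m. h (l i))" if "\<And>i. i < m \<Longrightarrow> l i \<in> L" for l and m :: nat
  proof -
    have "f (\<Sum>i<k. l i) = (\<Sum>i<k. f (l i))" for k
      by (induction k) (auto simp: f f0)
    then have "of_int N * f (\<Sum>i<m. l i) = (\<Sum>i<m. of_int (h (l i)))"
      using that by (simp add: hL sum_distrib_left)
    then show ?thesis
      by (simp add: h_def[of "sum l {..<m}"] flip: of_int_sum)
  qed
  ultimately show ?thesis
    by (rule that)
qed

lemma two_powi_inject:
  fixes a b :: int
  assumes "(2::'a::field_char_0) powi a = 2 powi b"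
  shows "a = b"
proof -
  have le: "b \<le> a" if "(2::'a) powi a = 2 powi b" for a b :: int
  proof (rule ccontr)
    assume "\<not> b \<le> a"
    then obtain m where m: "b = a + int m" "m > 0"
      using zero_less_imp_eq_int[of "b - a"] by (metis diff_gt_0_iff_gt add_diff_cancel_left' diff_add_cancel add.commute not_le)
    have "(2::'a) powi a * 2 ^ m = 2 powi a"
      using that m by (simp add: power_int_add)
    then have "(of_nat (2 ^ m) :: 'a) = of_nat 1"
      by simp
    then have "(2::nat) ^ m = 1"
      by (simp only: of_nat_eq_iff)
    with m show False by simp
  qed
  show ?thesis
    using le[OF assms] le[OF assms[symmetric]] by simp
qed

section \<open>Generalised eigenspaces\<close>

locale finite_dim_endomorphism = vector_space scale
  for scale :: "'f::{alg_closed_field, field_char_0} \<Rightarrow> 'v::ab_group_add \<Rightarrow> 'v" (infixr "*s" 75) +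
  fixes A :: "'v set" and T :: "'v \<Rightarrow> 'v"
  assumes subspace_A: "subspace A"
    and finite_span_A: "\<exists>B. finite B \<and> span B = A"
    and T_add: "T (x + y) = T x + T y"
    and T_scale: "T (c *s x) = c *s T x"
    and T_closed: "x \<in> A \<Longrightarrow> T x \<in> A"
begin

definition shift :: "'f \<Rightarrow> 'v \<Rightarrow> 'v" where
  "shift l x = T x - l *s x"

definition gen_eigenspace :: "'f \<Rightarrow> 'v set" where
  "gen_eigenspace l = {x \<in> A. \<exists>k. (shift l ^^ k) x = 0}"

lemma T_zero: "T 0 = 0"
  using T_scale[of 0 0] by simp

lemma shift_add: "shift l (x + y) = shift l x + shift l y"
  by (simp add: shift_def T_add algebra_simps)

lemma shift_scale: "shift l (c *s x) = c *s shift l x"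
  by (simp add: shift_def T_scale algebra_simps)

lemma shift_pow_add: "(shift l ^^ k) (x + y) = (shift l ^^ k) x + (shift l ^^ k) y"
  by (induction k) (simp_all add: shift_add)

lemma shift_pow_scale: "(shift l ^^ k) (c *s x) = c *s (shift l ^^ k) x"
  by (induction k) (simp_all add: shift_scale)

lemma shift_pow_zero: "(shift l ^^ k) 0 = 0"
  using shift_pow_scale[of k l 0 0] by simp

lemma shift_pow_sum: "(shift l ^^ k) (sum f S) = (\<Sum>i\<in>S. (shift l ^^ k) (f i))"
  by (induction S rule: infinite_finite_induct) (simp_all add: shift_pow_zero shift_pow_add)

lemma shift_sum: "shift l (sum f S) = (\<Sum>i\<in>S. shift l (f i))"
  using shift_pow_sum[of 1 l] by simp

lemma shift_pow_eq_0_mono: "(shift l ^^ k) x = 0 \<Longrightarrow> k \<le> k' \<Longrightarrow> (shift l ^^ k') x = 0"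
  by (metis add_diff_inverse_nat comp_apply funpow_add not_less add.commute shift_pow_zero)

lemma shift_change: "shift l x = shift m x + (m - l) *s x"
  by (simp add: shift_def algebra_simps)

lemma shift_commute: "shift l (shift m x) = shift m (shift l x)"
  unfolding shift_change[of l _ m] shift_add shift_scale ..

lemma shift_pow_commute: "(shift l ^^ k) (shift m x) = shift m ((shift l ^^ k) x)"
  by (induction k) (simp_all add: shift_commute)

lemma shift_closed: "x \<in> A \<Longrightarrow> shift l x \<in> A"
  by (simp add: shift_def subspace_diff subspace_A subspace_scale T_closed)

lemma shift_pow_closed: "x \<in> A \<Longrightarrow> (shift l ^^ k) x \<in> A"
  by (induction k) (simp_all add: shift_closed)

lemma gen_eigenspace_subset: "gen_eigenspace l \<subseteq> A"
  by (auto simp: gen_eigenspace_def)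

lemma gen_eigenspaceI: "x \<in> A \<Longrightarrow> (shift l ^^ k) x = 0 \<Longrightarrow> x \<in> gen_eigenspace l"
  by (auto simp: gen_eigenspace_def)

lemma subspace_gen_eigenspace: "subspace (gen_eigenspace l)"
proof (rule subspaceI)
  show "0 \<in> gen_eigenspace l"
    by (rule gen_eigenspaceI[of _ 0]) (simp_all add: subspace_0 subspace_A)
next
  fix x y assume "x \<in> gen_eigenspace l" "y \<in> gen_eigenspace l"
  then obtain j k where *: "x \<in> A" "y \<in> A" "(shift l ^^ j) x = 0" "(shift l ^^ k) y = 0"
    by (auto simp: gen_eigenspace_def)
  then have "(shift l ^^ max j k) x = 0" "(shift l ^^ max j k) y = 0"
    by (auto intro: shift_pow_eq_0_mono)
  with * show "x + y \<in> gen_eigenspace l"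
    by (intro gen_eigenspaceI[of _ "max j k"]) (simp_all add: shift_pow_add subspace_add subspace_A)
next
  fix c x assume "x \<in> gen_eigenspace l"
  then show "c *s x \<in> gen_eigenspace l"
    by (auto simp: gen_eigenspace_def shift_pow_scale subspace_scale subspace_A)
qed

lemma shift_gen_eigenspace: "x \<in> gen_eigenspace l \<Longrightarrow> shift m x \<in> gen_eigenspace l"
proof -
  assume "x \<in> gen_eigenspace l"
  then obtain k where k: "x \<in> A" "(shift l ^^ k) x = 0"
    by (auto simp: gen_eigenspace_def)
  then have "(shift l ^^ k) (shift m x) = shift m 0"
    by (simp add: shift_pow_commute)
  also have "shift m 0 = 0"
    by (simp add: shift_def T_zero)
  finally show ?thesis
    using k by (intro gen_eigenspaceI) (simp_all add: shift_closed)
qed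

lemma shift_pow_gen_eigenspace: "x \<in> gen_eigenspace l \<Longrightarrow> (shift m ^^ k) x \<in> gen_eigenspace l"
  by (induction k) (simp_all add: shift_gen_eigenspace)

text \<open>On \<open>gen_eigenspace m\<close> the map \<open>shift l\<close> is the nonzero scalar \<open>m - l\<close> plus the nilpotent map
  \<open>shift m\<close>.\<close>

lemma shift_surj_gen_eigenspace:
  assumes "x \<in> gen_eigenspace m" "m \<noteq> l"
  obtains y where "y \<in> gen_eigenspace m" "shift l y = x"
proof -
  have "\<exists>y\<in>gen_eigenspace m. shift l y = x" if "x \<in> A" "(shift m ^^ k) x = 0" for k x
    using that
  proof (induction k arbitrary: x)
    case 0
    then show ?case
      by (intro bexI[of _ 0]) (simp_all add: shift_def T_zero subspace_0 subspace_gen_eigenspace)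
  next
    case (Suc k)
    have "(shift m ^^ k) (shift m x) = 0"
      using Suc.prems by (simp add: shift_pow_commute)
    then obtain z where z: "z \<in> gen_eigenspace m" "shift l z = shift m x"
      using Suc.IH[of "shift m x"] Suc.prems shift_closed by blast
    let ?y = "inverse (m - l) *s (x - z)"
    have "?y \<in> gen_eigenspace m"
      using z(1) Suc.prems gen_eigenspaceI[of x "Suc k" m]
      by (intro subspace_scale subspace_diff subspace_gen_eigenspace) auto
    moreover have "shift l (x - z) = (m - l) *s x"
      using shift_add[of l "x - z" z] z(2) shift_change[of l x m] by simp
    then have "shift l ?y = x"
      using assms(2) by (simp add: shift_scale)
    ultimately show ?case
      by blast
  qed
  moreover obtain k where "x \<in> A" "(shift m ^^ k) x = 0"
    using assms(1) by (auto simp: gen_eigenspace_def)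
  ultimately show ?thesis
    using that by blast
qed

lemma shift_inj_gen_eigenspace:
  assumes "x \<in> gen_eigenspace m" "m \<noteq> l" "shift l x = 0"
  shows "x = 0"
proof -
  obtain k where k: "(shift m ^^ k) x = 0"
    using assms by (auto simp: gen_eigenspace_def)
  have "shift m x = (l - m) *s x"
    using shift_change[of m x l] assms(3) by simp
  then have "(shift m ^^ j) x = (l - m) ^ j *s x" for j
    by (induction j) (simp_all add: shift_scale)
  with k assms(2) show ?thesis
    by simp
qed

lemma shift_pow_inj_gen_eigenspace:
  assumes "x \<in> gen_eigenspace m" "m \<noteq> l" "(shift l ^^ k) x = 0"
  shows "x = 0"
  using assms(3)
proof (induction k)
  case (Suc k)
  then show ?case
    using shift_inj_gen_eigenspace[OF shift_pow_gen_eigenspace[OF assms(1)] assms(2)] by simp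
qed simp

text \<open>A power of \<open>shift m\<close> kills the component for \<open>m\<close> and is injective on all the others.\<close>

lemma gen_eigenspaces_independent:
  assumes "finite L" "\<And>l. l \<in> L \<Longrightarrow> g l \<in> gen_eigenspace l" "(\<Sum>l\<in>L. g l) = 0" "l \<in> L"
  shows "g l = 0"
  using assms
proof (induction L arbitrary: g l rule: finite_induct)
  case empty
  then show ?case by simp
next
  case (insert m L)
  obtain k where k: "(shift m ^^ k) (g m) = 0"
    using insert.prems(1)[of m] by (auto simp: gen_eigenspace_def)
  have rest: "g l = 0" if "l \<in> L" for l
  proof -
    have "(\<Sum>l\<in>L. (shift m ^^ k) (g l)) = 0"
      using arg_cong[OF insert.prems(2), of "shift m ^^ k"] insert.hyps k
      by (simp add: shift_pow_sum shift_pow_add shift_pow_zero)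
    with that have "(shift m ^^ k) (g l) = 0"
      by (intro insert.IH[of "\<lambda>l. (shift m ^^ k) (g l)"])
        (auto intro: shift_pow_gen_eigenspace insert.prems(1))
    then show ?thesis
      using shift_pow_inj_gen_eigenspace[of "g l" l m k] insert that by auto
  qed
  moreover have "g m = 0"
    using insert.prems(2) insert.hyps rest by simp
  ultimately show ?case
    using insert.prems(3) by blast
qed

abbreviation eigen_span :: "'v set" where
  "eigen_span \<equiv> span (\<Union>l. gen_eigenspace l)"

text \<open>The map \<open>shift l\<close> is invertible on all generalised eigenspaces except the one for \<open>l\<close>, so \<open>x\<close> can
  be corrected within the sum until \<open>shift l\<close> sends it to \<open>gen_eigenspace l\<close>.\<close>

lemma shift_in_eigen_spanD:
  assumes x: "x \<in> A" and "shift l x \<in> eigen_span"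
  shows "x \<in> eigen_span"
proof -
  have "\<exists>z\<in>eigen_span. \<exists>w\<in>gen_eigenspace l. y = shift l z + w" if "y \<in> eigen_span" for y
    using that
  proof (induction rule: span_induct_alt)
    case base
    show ?case
      by (intro bexI[of _ 0]) (simp_all add: shift_def T_zero span_zero subspace_0 subspace_gen_eigenspace)
  next
    case (step c b y)
    obtain z w where zw: "z \<in> eigen_span" "w \<in> gen_eigenspace l" "y = shift l z + w"
      using step.IH by blast
    obtain m where m: "b \<in> gen_eigenspace m"
      using step.hyps by blast
    show ?case
    proof (cases "m = l")
      case True
      have "c *s b + w \<in> gen_eigenspace l"
        using zw m True by (simp add: subspace_add subspace_scale subspace_gen_eigenspace)
      then show ?thesis
        using zw by (intro bexI[of _ z] bexI[of _ "c *s b + w"]) (simp_all add: algebra_simps)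
    next
      case False
      then obtain b' where b': "b' \<in> gen_eigenspace m" "shift l b' = b"
        using shift_surj_gen_eigenspace[OF m] by blast
      have "c *s b' + z \<in> eigen_span"
        using b'(1) zw(1) by (intro span_add span_scale) (auto intro: span_base)
      then show ?thesis
        using zw b' by (intro bexI[of _ "c *s b' + z"] bexI[of _ w])
          (simp_all add: shift_add shift_scale)
    qed
  qed
  then obtain z w where zw: "z \<in> eigen_span" "w \<in> gen_eigenspace l" "shift l x = shift l z + w"
    using assms(2) by blast
  have "eigen_span \<subseteq> A"
    using gen_eigenspace_subset subspace_A by (intro span_minimal) auto
  then have "x - z \<in> A"
    using x zw(1) subspace_diff[OF subspace_A] by blast
  moreover have "shift l (x - z) = w"
    using shift_add[of l "x - z" z] zw(3) by simp
  moreover obtain k where "(shift l ^^ k) w = 0"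
    using zw(2) by (auto simp: gen_eigenspace_def)
  ultimately have "x - z \<in> gen_eigenspace l"
    using gen_eigenspaceI[of "x - z" "Suc k" l] shift_pow_commute[of k l l "x - z"] by simp
  then have "x - z \<in> eigen_span"
    by (auto intro: span_base)
  from span_add[OF this zw(1)] show ?thesis
    by simp
qed

definition apply_poly :: "'f poly \<Rightarrow> 'v \<Rightarrow> 'v" where
  "apply_poly p v = (\<Sum>i\<le>degree p. coeff p i *s (T ^^ i) v)"

lemma apply_poly_altdef:
  "degree p \<le> N \<Longrightarrow> apply_poly p v = (\<Sum>i\<le>N. coeff p i *s (T ^^ i) v)"
  unfolding apply_poly_def
  by (rule sum.mono_neutral_left) (auto simp: coeff_eq_0)

lemma T_pow_add: "(T ^^ k) (x + y) = (T ^^ k) x + (T ^^ k) y"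
  by (induction k) (simp_all add: T_add)

lemma T_pow_scale: "(T ^^ k) (c *s x) = c *s (T ^^ k) x"
  by (induction k) (simp_all add: T_scale)

lemma apply_poly_linear_factor: "apply_poly ([:- l, 1:] * q) v = apply_poly q (shift l v)"
proof -
  let ?N = "Suc (degree q)"
  have "degree ([:- l, 1:] * q) \<le> ?N"
    by (rule order.trans[OF degree_mult_le]) simp
  then have "apply_poly ([:- l, 1:] * q) v
      = (\<Sum>i\<le>?N. coeff ([:- l, 1:] * q) i *s (T ^^ i) v)"
    by (rule apply_poly_altdef)
  also have "\<dots> = (\<Sum>i\<le>?N. coeff (pCons 0 q) i *s (T ^^ i) v) - (\<Sum>i\<le>?N. l *s (coeff q i *s (T ^^ i) v))"
    unfolding sum_subtractf[symmetric]
    by (intro sum.cong) (simp_all add: scale_left_diff_distrib[symmetric])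
  also have "(\<Sum>i\<le>?N. coeff (pCons 0 q) i *s (T ^^ i) v) = (\<Sum>i\<le>degree q. coeff q i *s (T ^^ i) (T v))"
    by (simp add: sum.atMost_Suc_shift funpow_swap1 del: sum.atMost_Suc)
  also have "\<dots> = apply_poly q (T v)"
    by (simp add: apply_poly_def)
  also have "(\<Sum>i\<le>?N. l *s (coeff q i *s (T ^^ i) v)) = apply_poly q (l *s v)"
    unfolding apply_poly_altdef[of q ?N, OF le_SucI[OF order.refl]]
    by (intro sum.cong) (simp_all add: T_pow_scale mult.commute)
  also have "apply_poly q (T v) - apply_poly q (l *s v) = apply_poly q (shift l v)"
    unfolding apply_poly_def shift_def sum_subtractf[symmetric]
    by (intro sum.cong refl) (metis T_pow_add diff_add_cancel add_diff_cancel scale_right_distrib)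
  finally show ?thesis .
qed

text \<open>Over an algebraically closed field \<open>p\<close> splits, and each linear factor \<open>X - l\<close> acts as \<open>shift l\<close>; the
  factors are removed one at a time.\<close>

lemma apply_poly_in_eigen_spanD:
  assumes "v \<in> A" "p \<noteq> 0" "apply_poly p v \<in> eigen_span"
  shows "v \<in> eigen_span"
  using assms
proof (induction "degree p" arbitrary: p v)
  case 0
  then obtain c where "p = [:c:]" "c \<noteq> 0"
    by (metis degree_eq_zeroE pCons_eq_0_iff)
  with 0 have "inverse c *s (c *s v) \<in> eigen_span"
    by (intro span_scale[of "c *s v"]) (simp add: apply_poly_def)
  with \<open>c \<noteq> 0\<close> show ?case by simp
next
  case (Suc d)
  obtain l where "poly p l = 0"
    using alg_closed_imp_poly_has_root[of p] Suc.hyps by auto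
  then obtain q where q: "p = [:- l, 1:] * q"
    by (auto simp: poly_eq_0_iff_dvd)
  then have "q \<noteq> 0"
    using Suc.prems by auto
  then have "degree p = Suc (degree q)"
    unfolding q by (subst degree_mult_eq) simp_all
  moreover have "apply_poly q (shift l v) \<in> eigen_span"
    using Suc.prems(3) unfolding q apply_poly_linear_factor .
  ultimately have "shift l v \<in> eigen_span"
    using Suc.hyps \<open>q \<noteq> 0\<close> Suc.prems(1) shift_closed by simp
  then show ?case
    using shift_in_eigen_spanD Suc.prems(1) by blast
qed

lemma ex_annihilating_poly:
  assumes "v \<in> A"
  shows "\<exists>p. p \<noteq> 0 \<and> apply_poly p v = 0"
proof -
  obtain B where B: "finite B" "span B = A"
    using finite_span_A by blast
  let ?N = "card B" and ?f = "\<lambda>i. (T ^^ i) v"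
  have mem: "?f i \<in> A" for i
    by (induction i) (simp_all add: assms T_closed)
  have "\<exists>u. (\<exists>i\<le>?N. u i \<noteq> 0) \<and> (\<Sum>i\<le>?N. u i *s ?f i) = 0"
  proof (cases "inj_on ?f {..?N}")
    case True
    have "card (?f ` {..?N}) = Suc ?N"
      using True by (simp add: card_image)
    then have "dependent (?f ` {..?N})"
      using independent_span_bound[OF B(1), of "?f ` {..?N}"] mem B(2) by fastforce
    then obtain u where u: "\<exists>w\<in>?f ` {..?N}. u w \<noteq> 0" "(\<Sum>w\<in>?f ` {..?N}. u w *s w) = 0"
      unfolding dependent_finite[OF finite_imageI[OF finite_atMost]] by blast
    then show ?thesis
      by (intro exI[of _ "u \<circ> ?f"]) (auto simp: sum.reindex[OF True] o_def)
  next
    case False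
    then obtain i j where ij: "i \<le> ?N" "j \<le> ?N" "i \<noteq> j" "?f i = ?f j"
      by (auto simp: inj_on_def)
    let ?u = "\<lambda>k. if k = i then 1 else if k = j then - 1 else 0 :: 'f"
    have "(\<Sum>k\<le>?N. ?u k *s ?f k) = (\<Sum>k\<in>{i, j}. ?u k *s ?f k)"
      using ij by (intro sum.mono_neutral_right) auto
    also have "\<dots> = 0"
      using ij by simp
    finally show ?thesis
      using ij by (intro exI[of _ ?u]) auto
  qed
  then obtain u i where u: "i \<le> ?N" "u i \<noteq> 0" "(\<Sum>i\<le>?N. u i *s ?f i) = 0"
    by blast
  define p where "p = (\<Sum>i\<le>?N. monom (u i) i)"
  have coeff: "coeff p j = (if j \<le> ?N then u j else 0)" for j
    by (simp add: p_def coeff_sum)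
  then have "degree p \<le> ?N"
    by (intro degree_le) simp
  then have "apply_poly p v = 0"
    using u by (simp add: apply_poly_altdef coeff)
  moreover have "p \<noteq> 0"
    using u coeff[of i] by auto
  ultimately show ?thesis
    by blast
qed

lemma eigen_span_eq: "eigen_span = A"
proof
  show "eigen_span \<subseteq> A"
    using gen_eigenspace_subset subspace_A by (intro span_minimal) auto
  show "A \<subseteq> eigen_span"
    using ex_annihilating_poly apply_poly_in_eigen_spanD span_zero by (metis subsetI)
qed

text \<open>A finite spanning set involves only finitely many weights and has a common nilpotency index;
  independence of the generalised eigenspaces carries both over to all of \<open>A\<close>. The index is enlarged
  to at least 2, so that truncating an exponential series at \<open>K\<close> keeps the linear term.\<close>

lemma ex_eigen_decomposition:
  obtains L K where "finite L" "K \<ge> 2"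
    and "\<And>x. x \<in> A \<Longrightarrow> \<exists>g. (\<forall>l. g l \<in> gen_eigenspace l) \<and> x = (\<Sum>l\<in>L. g l)"
    and "\<And>l x. x \<in> gen_eigenspace l \<Longrightarrow> (shift l ^^ K) x = 0"
    and "\<And>l x. x \<in> gen_eigenspace l \<Longrightarrow> l \<notin> L \<Longrightarrow> x = 0"
proof -
  obtain B where B: "finite B" "span B = A"
    using finite_span_A by blast
  have "\<exists>S. finite S \<and> S \<subseteq> (\<Union>l. gen_eigenspace l) \<and> b \<in> span S" if "b \<in> B" for b
  proof -
    have "b \<in> eigen_span"
      using that B span_base eigen_span_eq by blast
    then obtain S r where "finite S" "S \<subseteq> (\<Union>l. gen_eigenspace l)" "b = (\<Sum>a\<in>S. r a *s a)"
      unfolding span_explicit by blast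
    then show ?thesis
      by (intro exI[of _ S]) (auto intro!: span_sum span_scale intro: span_base)
  qed
  then obtain S where S: "\<And>b. b \<in> B \<Longrightarrow> finite (S b) \<and> S b \<subseteq> (\<Union>l. gen_eigenspace l) \<and> b \<in> span (S b)"
    by metis
  define F where "F = (\<Union>b\<in>B. S b)"
  have F: "finite F" "F \<subseteq> (\<Union>l. gen_eigenspace l)"
    using B S by (auto simp: F_def)
  have "B \<subseteq> span F"
    using S span_mono[of "S _" F] by (fastforce simp: F_def)
  then have spanF: "A \<subseteq> span F"
    using B by (metis span_minimal subspace_span)
  have "\<forall>b\<in>F. \<exists>l k. b \<in> A \<and> (shift l ^^ k) b = 0"
    using F(2) unfolding gen_eigenspace_def by blast
  then obtain w k where wk: "\<And>b. b \<in> F \<Longrightarrow> b \<in> A" "\<And>b. b \<in> F \<Longrightarrow> (shift (w b) ^^ k b) b = 0"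
    by metis
  define K where "K = (\<Sum>b\<in>F. k b) + 2"
  have K: "(shift (w b) ^^ K) b = 0" if "b \<in> F" for b
    using shift_pow_eq_0_mono[OF wk(2)[OF that], of K] member_le_sum[OF that, of k] F(1)
    by (simp add: K_def)
  let ?L = "w ` F"
  have dec: "\<exists>g. (\<forall>l. g l \<in> gen_eigenspace l) \<and> (\<forall>l. (shift l ^^ K) (g l) = 0) \<and> x = (\<Sum>l\<in>?L. g l)"
    if x: "x \<in> A" for x
  proof -
    obtain u where u: "x = (\<Sum>b\<in>F. u b *s b)"
      using spanF x span_finite[OF F(1)] by auto
    define g where "g l = (\<Sum>b\<in>{b\<in>F. w b = l}. u b *s b)" for l
    have z: "(shift l ^^ K) (g l) = 0" for l
      using K unfolding g_def shift_pow_sum by (intro sum.neutral) (auto simp: shift_pow_scale)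
    moreover have "g l \<in> A" for l
      using wk(1) unfolding g_def by (intro subspace_sum subspace_scale subspace_A) auto
    ultimately have "g l \<in> gen_eigenspace l" for l
      using gen_eigenspaceI by blast
    moreover have "x = (\<Sum>l\<in>?L. g l)"
      unfolding u g_def by (rule sum.image_gen[OF F(1)])
    ultimately show ?thesis
      using z by blast
  qed
  have uniq: "(shift m ^^ K) x = 0 \<and> (m \<notin> ?L \<longrightarrow> x = 0)" if x: "x \<in> gen_eigenspace m" for m x
  proof -
    obtain g where g: "\<And>l. g l \<in> gen_eigenspace l" "\<And>l. (shift l ^^ K) (g l) = 0" "x = (\<Sum>l\<in>?L. g l)"
      using dec[of x] x gen_eigenspace_subset by blast
    define h where "h l = (if l \<in> ?L then g l else 0) - (if l = m then x else 0)" for l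
    have "(\<Sum>l\<in>insert m ?L. h l) = (\<Sum>l\<in>?L. g l) - x"
      unfolding h_def sum_subtractf using F(1)
      by (intro arg_cong2[where f = minus] sum.mono_neutral_cong_right) (auto simp: if_distrib)
    then have "(\<Sum>l\<in>insert m ?L. h l) = 0"
      using g(3) by simp
    moreover have "h l \<in> gen_eigenspace l" for l
      using g(1) x unfolding h_def
      by (intro subspace_diff subspace_gen_eigenspace) (auto simp: subspace_0 subspace_gen_eigenspace)
    ultimately have "h m = 0"
      using gen_eigenspaces_independent[of "insert m ?L" h m] F(1) by simp
    then have "x = (if m \<in> ?L then g m else 0)"
      by (simp add: h_def)
    with g(2) show ?thesis
      by (auto simp: shift_pow_zero)
  qed
  show ?thesis
  proof (rule that[of ?L K])
    show "\<exists>g. (\<forall>l. g l \<in> gen_eigenspace l) \<and> x = (\<Sum>l\<in>?L. g l)" if "x \<in> A" for x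
      using dec[OF that] by blast
  qed (use F(1) uniq in \<open>auto simp: K_def\<close>)
qed

end

section \<open>Multilinear expansion of the bracket\<close>

context n_Lie_algebra
begin

text \<open>Families \<open>nat \<Rightarrow> 'v\<close> are more convenient than lists for expanding all arguments at once.\<close>

definition bracket :: "(nat \<Rightarrow> 'v) \<Rightarrow> 'v" where
  "bracket x = br (map x [0..<n])"

lemma bracket_cong: "(\<And>i. i < n \<Longrightarrow> x i = y i) \<Longrightarrow> bracket x = bracket y"
  unfolding bracket_def by (intro arg_cong[of _ _ br] map_cong) auto

lemma bracket_nth: "length xs = n \<Longrightarrow> bracket ((!) xs) = br xs"
  using map_nth[of xs] by (simp add: bracket_def)

lemma bracket_closed: "(\<And>i. i < n \<Longrightarrow> x i \<in> A) \<Longrightarrow> bracket x \<in> A"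
  unfolding bracket_def by (intro br_closed) auto

lemma bracket_upd: "i < n \<Longrightarrow> bracket (x(i := v)) = br ((map x [0..<n])[i := v])"
  unfolding bracket_def by (intro arg_cong[of _ _ br] nth_equalityI) (auto simp: nth_list_update)

lemma bracket_add:
  assumes "\<And>j. j < n \<Longrightarrow> x j \<in> A" "i < n" "a \<in> A" "b \<in> A"
  shows "bracket (x(i := a + b)) = bracket (x(i := a)) + bracket (x(i := b))"
  unfolding bracket_upd[OF assms(2)] using assms by (intro br_add) auto

lemma bracket_scale:
  assumes "\<And>j. j < n \<Longrightarrow> x j \<in> A" "i < n" "a \<in> A"
  shows "bracket (x(i := scale c a)) = scale c (bracket (x(i := a)))"
  unfolding bracket_upd[OF assms(2)] using assms by (intro br_scale) auto

lemma bracket_eq_0: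
  assumes "\<And>j. j < n \<Longrightarrow> x j \<in> A" "i < n" "x i = 0"
  shows "bracket x = 0"
proof -
  have "bracket (x(i := scale 0 0)) = scale 0 (bracket (x(i := 0)))"
    using assms subspace_0[OF subspace_carrier] by (intro bracket_scale)
  moreover have "x(i := 0) = x"
    using assms(3) by auto
  ultimately show ?thesis
    by simp
qed

lemma bracket_sum:
  assumes "\<And>j. j < n \<Longrightarrow> x j \<in> A" "i < n" "finite S" "\<And>s. s \<in> S \<Longrightarrow> v s \<in> A"
  shows "bracket (x(i := \<Sum>s\<in>S. v s)) = (\<Sum>s\<in>S. bracket (x(i := v s)))"
  using assms(3,4)
proof (induction S rule: finite_induct)
  case empty
  show ?case
    using assms subspace_0[OF subspace_carrier] by (simp add: bracket_eq_0[of _ i])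
next
  case (insert s S)
  then have "(\<Sum>s\<in>S. v s) \<in> A"
    by (intro subspace_sum subspace_carrier) auto
  then show ?case
    using insert assms(1,2) by (simp add: bracket_add del: fun_upd_apply)
qed

text \<open>The arguments are expanded from left to right; \<open>r\<close> counts those already expanded.\<close>

lemma bracket_sum_all:
  assumes J: "finite J" and v: "\<And>i j. i < n \<Longrightarrow> j \<in> J \<Longrightarrow> v i j \<in> A"
  shows "bracket (\<lambda>i. \<Sum>j\<in>J. v i j) = (\<Sum>k\<in>{..<n} \<rightarrow>\<^sub>E J. bracket (\<lambda>i. v i (k i)))"
proof -
  have S: "(\<Sum>j\<in>J. v i j) \<in> A" if "i < n" for i
    using v that by (intro subspace_sum subspace_carrier) auto
  have "bracket (\<lambda>i. if i < r then \<Sum>j\<in>J. v i j else y i)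
      = (\<Sum>k\<in>{..<r} \<rightarrow>\<^sub>E J. bracket (\<lambda>i. if i < r then v i (k i) else y i))"
    if "r \<le> n" "\<And>i. i < n \<Longrightarrow> y i \<in> A" for r y
    using that
  proof (induction r arbitrary: y)
    case 0
    show ?case by simp
  next
    case (Suc r)
    let ?y = "y(r := \<Sum>j\<in>J. v r j)"
    have upd: "(\<lambda>i. if i < r then v i (k i) else y i)(r := v r j)
        = (\<lambda>i. if i < Suc r then v i ((k(r := j)) i) else y i)" for j k
      by auto
    have "bracket (\<lambda>i. if i < Suc r then \<Sum>j\<in>J. v i j else y i)
        = bracket (\<lambda>i. if i < r then \<Sum>j\<in>J. v i j else ?y i)"
      by (intro arg_cong[of _ _ bracket]) (auto simp: less_Suc_eq)
    also have "\<dots> = (\<Sum>k\<in>{..<r} \<rightarrow>\<^sub>E J. bracket (\<lambda>i. if i < r then v i (k i) else ?y i))"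
      using Suc.prems S by (intro Suc.IH) auto
    also have "\<dots> = (\<Sum>k\<in>{..<r} \<rightarrow>\<^sub>E J. \<Sum>j\<in>J.
        bracket ((\<lambda>i. if i < r then v i (k i) else y i)(r := v r j)))"
    proof (rule sum.cong[OF refl])
      fix k assume k: "k \<in> {..<r} \<rightarrow>\<^sub>E J"
      have "(\<lambda>i. if i < r then v i (k i) else ?y i)
          = (\<lambda>i. if i < r then v i (k i) else y i)(r := \<Sum>j\<in>J. v r j)"
        by auto
      then show "bracket (\<lambda>i. if i < r then v i (k i) else ?y i)
          = (\<Sum>j\<in>J. bracket ((\<lambda>i. if i < r then v i (k i) else y i)(r := v r j)))"
        using Suc.prems k v J by (simp only:) (intro bracket_sum, auto)
    qed
    also have "\<dots> = (\<Sum>j\<in>J. \<Sum>k\<in>{..<r} \<rightarrow>\<^sub>E J.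
        bracket ((\<lambda>i. if i < r then v i (k i) else y i)(r := v r j)))"
      by (rule sum.swap)
    also have "\<dots> = (\<Sum>(j, k)\<in>J \<times> ({..<r} \<rightarrow>\<^sub>E J).
        bracket ((\<lambda>i. if i < r then v i (k i) else y i)(r := v r j)))"
      by (rule sum.cartesian_product)
    also have "\<dots> = (\<Sum>(j, k)\<in>J \<times> ({..<r} \<rightarrow>\<^sub>E J).
        bracket (\<lambda>i. if i < Suc r then v i ((k(r := j)) i) else y i))"
      by (simp only: upd)
    also have "\<dots> = (\<Sum>k\<in>insert r {..<r} \<rightarrow>\<^sub>E J. bracket (\<lambda>i. if i < Suc r then v i (k i) else y i))"
      unfolding PiE_insert_eq
      by (subst sum.reindex[OF inj_combinator]) (simp_all add: case_prod_unfold o_def)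
    also have "insert r {..<r} = {..<Suc r}"
      by auto
    finally show ?case .
  qed
  from this[of n "\<lambda>_. 0"] show ?thesis
    using subspace_0[OF subspace_carrier] by (simp cong: bracket_cong)
qed

lemma bracket_scale_all:
  assumes x: "\<And>i. i < n \<Longrightarrow> x i \<in> A"
  shows "bracket (\<lambda>i. scale (c i) (x i)) = scale (\<Prod>i<n. c i) (bracket x)"
proof -
  let ?f = "\<lambda>r i. if i < r then scale (c i) (x i) else x i"
  have "bracket (?f r) = scale (\<Prod>i<r. c i) (bracket x)" if "r \<le> n" for r
    using that
  proof (induction r)
    case 0
    show ?case by simp
  next
    case (Suc r)
    have "bracket (?f (Suc r)) = bracket ((?f r)(r := scale (c r) (x r)))"
      by (intro arg_cong[of _ _ bracket]) auto
    also have "\<dots> = scale (c r) (bracket ((?f r)(r := x r)))"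
      using Suc.prems x subspace_scale[OF subspace_carrier] by (intro bracket_scale) auto
    also have "(?f r)(r := x r) = ?f r"
      by auto
    finally show ?case
      using Suc by (simp add: mult.commute)
  qed
  from this[of n] show ?thesis
    by (simp cong: bracket_cong)
qed

end

section \<open>The Leibniz rule for a derivation\<close>

locale n_Lie_derivation = n_Lie_algebra scale n br A + finite_dim_endomorphism scale A T
  for scale :: "'f::{alg_closed_field, field_char_0} \<Rightarrow> 'v::ab_group_add \<Rightarrow> 'v" (infixr "*s" 75)
    and n br A T +
  assumes T_bracket: "(\<And>i. i < n \<Longrightarrow> x i \<in> A) \<Longrightarrow> T (bracket x) = (\<Sum>i<n. bracket (x(i := T (x i))))"
begin

lemma shift_bracket:
  assumes x: "\<And>i. i < n \<Longrightarrow> x i \<in> A"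
  shows "shift (\<Sum>i<n. l i) (bracket x) = (\<Sum>i<n. bracket (x(i := shift (l i) (x i))))"
proof -
  have "bracket (x(i := shift (l i) (x i))) = bracket (x(i := T (x i))) - l i *s bracket x"
    if i: "i < n" for i
  proof -
    have "bracket (x(i := T (x i))) = bracket (x(i := shift (l i) (x i) + l i *s x i))"
      by (simp add: shift_def)
    also have "\<dots> = bracket (x(i := shift (l i) (x i))) + bracket (x(i := l i *s x i))"
      using x i by (intro bracket_add) (auto simp: shift_closed subspace_scale subspace_A)
    also have "bracket (x(i := l i *s x i)) = l i *s bracket (x(i := x i))"
      using x i by (intro bracket_scale) auto
    also have "x(i := x i) = x"
      by simp
    finally show ?thesis
      by (simp only: eq_diff_eq)
  qed
  then show ?thesis
    by (simp add: shift_def T_bracket[OF x] sum_subtractf scale_sum_left)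
qed

definition divided_power :: "'f \<Rightarrow> nat \<Rightarrow> 'v \<Rightarrow> 'v" where
  "divided_power l j x = inverse (fact j) *s (shift l ^^ j) x"

lemma divided_power_0: "divided_power l 0 x = x"
  by (simp add: divided_power_def)

lemma divided_power_1: "divided_power l (Suc 0) x = shift l x"
  by (simp add: divided_power_def)

lemma divided_power_add: "divided_power l j (x + y) = divided_power l j x + divided_power l j y"
  by (simp add: divided_power_def shift_pow_add scale_right_distrib)

lemma divided_power_scale: "divided_power l j (c *s x) = c *s divided_power l j x"
  by (simp add: divided_power_def shift_pow_scale mult.commute)

lemma divided_power_closed: "x \<in> A \<Longrightarrow> divided_power l j x \<in> A"
  by (simp add: divided_power_def subspace_scale subspace_A shift_pow_closed)

lemma divided_power_gen_eigenspace:
  "x \<in> gen_eigenspace m \<Longrightarrow> divided_power l j x \<in> gen_eigenspace m"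
  by (simp add: divided_power_def subspace_scale subspace_gen_eigenspace shift_pow_gen_eigenspace)

lemma shift_divided_power: "shift l (divided_power l j x) = of_nat (Suc j) *s divided_power l (Suc j) x"
  by (simp add: divided_power_def shift_scale field_simps del: of_nat_Suc)

text \<open>Extensionality makes each \<open>n\<close>-tuple of exponents occur exactly once.\<close>

definition multidegrees :: "nat \<Rightarrow> (nat \<Rightarrow> nat) set" where
  "multidegrees m = {k \<in> extensional {..<n}. (\<Sum>i<n. k i) = m}"

lemma finite_multidegrees: "finite (multidegrees m)"
proof (rule finite_subset)
  show "multidegrees m \<subseteq> {..<n} \<rightarrow>\<^sub>E {..m}"
    by (auto simp: multidegrees_def PiE_def intro: member_le_sum)
qed (intro finite_PiE, auto)

lemma sum_fun_upd_Suc: "i < n \<Longrightarrow> (\<Sum>j<n. (k(i := Suc (k i))) j) = Suc (\<Sum>j<n. k j)"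
  by (simp add: sum.remove[of "{..<n}" i])

text \<open>The Leibniz rule, without multinomial coefficients because of the divided powers. Each argument
  has its own shift, and the shifts add up.\<close>

lemma divided_power_bracket:
  assumes x: "\<And>i. i < n \<Longrightarrow> x i \<in> A"
  shows "divided_power (\<Sum>i<n. l i) m (bracket x)
    = (\<Sum>k\<in>multidegrees m. bracket (\<lambda>i. divided_power (l i) (k i) (x i)))"
proof (induction m)
  case 0
  have "multidegrees 0 = {restrict (\<lambda>_. 0) {..<n}}"
    by (auto simp: multidegrees_def extensional_def)
  then show ?case
    by (simp add: divided_power_0 cong: bracket_cong)
next
  case (Suc m)
  let ?l = "\<Sum>i<n. l i" and ?h = "\<lambda>k. bracket (\<lambda>i. divided_power (l i) (k i) (x i))"
  have "of_nat (Suc m) *s divided_power ?l (Suc m) (bracket x) = shift ?l (\<Sum>k\<in>multidegrees m. ?h k)"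
    by (simp only: shift_divided_power[symmetric] Suc.IH)
  also have "\<dots> = (\<Sum>k\<in>multidegrees m. \<Sum>i<n. of_nat (Suc (k i)) *s ?h (k(i := Suc (k i))))"
    unfolding shift_sum
  proof (intro sum.cong refl)
    fix k
    let ?y = "\<lambda>i. divided_power (l i) (k i) (x i)"
    have "shift ?l (bracket ?y) = (\<Sum>i<n. bracket (?y(i := shift (l i) (?y i))))"
      by (intro shift_bracket divided_power_closed x)
    also have "\<dots> = (\<Sum>i<n. of_nat (Suc (k i)) *s ?h (k(i := Suc (k i))))"
    proof (intro sum.cong refl)
      fix i assume i: "i \<in> {..<n}"
      have "bracket (?y(i := shift (l i) (?y i)))
          = of_nat (Suc (k i)) *s bracket (?y(i := divided_power (l i) (Suc (k i)) (x i)))"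
        unfolding shift_divided_power using i x by (intro bracket_scale divided_power_closed) auto
      also have "?y(i := divided_power (l i) (Suc (k i)) (x i))
          = (\<lambda>j. divided_power (l j) ((k(i := Suc (k i))) j) (x j))"
        by auto
      finally show "bracket (?y(i := shift (l i) (?y i))) = of_nat (Suc (k i)) *s ?h (k(i := Suc (k i)))" .
    qed
    finally show "shift ?l (bracket ?y) = (\<Sum>i<n. of_nat (Suc (k i)) *s ?h (k(i := Suc (k i))))" .
  qed
  also have "\<dots> = (\<Sum>i<n. \<Sum>k\<in>multidegrees m. of_nat (Suc (k i)) *s ?h (k(i := Suc (k i))))"
    by (rule sum.swap)
  (* For fixed i, raising the exponent k i is a bijection onto the multidegrees that are positive at i;
     the others contribute 0 because of the factor k i. *)
  also have "\<dots> = (\<Sum>i<n. \<Sum>k\<in>multidegrees (Suc m). of_nat (k i) *s ?h k)"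
  proof (rule sum.cong[OF refl])
    fix i assume "i \<in> {..<n}"
    then have i: "i < n" by simp
    have "(\<Sum>k\<in>multidegrees m. of_nat (Suc (k i)) *s ?h (k(i := Suc (k i))))
        = (\<Sum>k\<in>{k \<in> multidegrees (Suc m). 0 < k i}. of_nat (k i) *s ?h k)"
    proof (rule sum.reindex_bij_witness[of _ "\<lambda>k. k(i := k i - 1)" "\<lambda>k. k(i := Suc (k i))"])
      fix k assume "k \<in> {k \<in> multidegrees (Suc m). 0 < k i}"
      then have k: "k \<in> extensional {..<n}" "(\<Sum>j<n. k j) = Suc m" "0 < k i"
        by (auto simp: multidegrees_def)
      let ?k = "k(i := k i - 1)"
      show inv: "?k(i := Suc (?k i)) = k"
        using k by auto
      have "Suc (\<Sum>j<n. ?k j) = Suc m"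
        using sum_fun_upd_Suc[OF i, of ?k] k(2) unfolding inv by simp
      then show "?k \<in> multidegrees m"
        using k i by (auto simp: multidegrees_def extensional_def)
    next
      fix k assume "k \<in> multidegrees m"
      then show "k(i := Suc (k i)) \<in> {k \<in> multidegrees (Suc m). 0 < k i}"
        using i sum_fun_upd_Suc[OF i, of k] by (auto simp: multidegrees_def extensional_def)
    qed auto
    also have "\<dots> = (\<Sum>k\<in>multidegrees (Suc m). of_nat (k i) *s ?h k)"
      by (rule sum.mono_neutral_left) (auto simp: finite_multidegrees)
    finally show "(\<Sum>k\<in>multidegrees m. of_nat (Suc (k i)) *s ?h (k(i := Suc (k i))))
        = (\<Sum>k\<in>multidegrees (Suc m). of_nat (k i) *s ?h k)" .
  qed
  also have "\<dots> = (\<Sum>k\<in>multidegrees (Suc m). \<Sum>i<n. of_nat (k i) *s ?h k)"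
    by (rule sum.swap)
  also have "\<dots> = (\<Sum>k\<in>multidegrees (Suc m). of_nat (Suc m) *s ?h k)"
    by (intro sum.cong refl)
      (simp add: multidegrees_def flip: scale_sum_left of_nat_sum del: of_nat_Suc)
  also have "\<dots> = of_nat (Suc m) *s (\<Sum>k\<in>multidegrees (Suc m). ?h k)"
    by (rule scale_sum_right[symmetric])
  finally show ?case
    by (simp del: of_nat_Suc)
qed

end

section \<open>Automorphisms from a derivation\<close>

locale n_Lie_derivation_decomposed = n_Lie_derivation scale n br A T
  for scale :: "'f::{alg_closed_field, field_char_0} \<Rightarrow> 'v::ab_group_add \<Rightarrow> 'v" (infixr "*s" 75)
    and n br A T +
  fixes L :: "'f set" and K :: nat
  assumes finite_L: "finite L" and K_ge_2: "K \<ge> 2"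
    and decomposition: "x \<in> A \<Longrightarrow> \<exists>g. (\<forall>l. g l \<in> gen_eigenspace l) \<and> x = (\<Sum>l\<in>L. g l)"
    and shift_pow_K: "x \<in> gen_eigenspace l \<Longrightarrow> (shift l ^^ K) x = 0"
    and gen_eigenspace_trivial: "x \<in> gen_eigenspace l \<Longrightarrow> l \<notin> L \<Longrightarrow> x = 0"
begin

lemma gen_eigenspace_in_A: "x \<in> gen_eigenspace l \<Longrightarrow> x \<in> A"
  using gen_eigenspace_subset by blast

lemma divided_power_eq_0: "x \<in> gen_eigenspace l \<Longrightarrow> K \<le> j \<Longrightarrow> divided_power l j x = 0"
  using shift_pow_eq_0_mono[OF shift_pow_K] by (simp add: divided_power_def)

definition exp_shift :: "'f \<Rightarrow> 'f \<Rightarrow> 'v \<Rightarrow> 'v" where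
  "exp_shift s l x = (\<Sum>j<K. s ^ j *s divided_power l j x)"

lemma exp_shift_add: "exp_shift s l (x + y) = exp_shift s l x + exp_shift s l y"
  by (simp add: exp_shift_def divided_power_add scale_right_distrib sum.distrib)

lemma exp_shift_scale: "exp_shift s l (c *s x) = c *s exp_shift s l x"
  by (simp add: exp_shift_def divided_power_scale scale_sum_right mult.commute)

lemma exp_shift_zero: "exp_shift s l 0 = 0"
  using exp_shift_scale[of s l 0 0] by simp

lemma exp_shift_gen_eigenspace: "x \<in> gen_eigenspace m \<Longrightarrow> exp_shift s l x \<in> gen_eigenspace m"
  unfolding exp_shift_def
  by (intro subspace_sum subspace_scale subspace_gen_eigenspace divided_power_gen_eigenspace)

lemma large_degree_arg:
  assumes "n * K \<le> (\<Sum>i<n. k i)"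
  shows "\<exists>i<n. K \<le> k i"
proof (rule ccontr)
  assume "\<not> ?thesis"
  then have "(\<Sum>i<n. k i) < (\<Sum>i<n. K)"
    using n_ge_2 by (intro sum_strict_mono) (auto simp: not_le lessThan_empty_iff)
  with assms show False
    by simp
qed

text \<open>Among \<open>n\<close> exponents with sum at least \<open>n * K\<close> one is at least \<open>K\<close>, so every term of the
  Leibniz rule vanishes in degree \<open>n * K\<close>.\<close>

lemma bracket_gen_eigenspace:
  assumes x: "\<And>i. i < n \<Longrightarrow> x i \<in> gen_eigenspace (l i)"
  shows "bracket x \<in> gen_eigenspace (\<Sum>i<n. l i)"
proof -
  have xA: "x i \<in> A" if "i < n" for i
    using x that gen_eigenspace_in_A by blast
  have "divided_power (\<Sum>i<n. l i) (n * K) (bracket x) = 0"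
  proof (subst divided_power_bracket[OF xA], assumption, intro sum.neutral ballI)
    fix k assume "k \<in> multidegrees (n * K)"
    then obtain i where "i < n" "K \<le> k i"
      using large_degree_arg[of k] by (auto simp: multidegrees_def)
    then show "bracket (\<lambda>i. divided_power (l i) (k i) (x i)) = 0"
      using xA x by (intro bracket_eq_0[of _ i] divided_power_closed divided_power_eq_0) auto
  qed
  then show ?thesis
    using gen_eigenspaceI[OF bracket_closed[OF xA]] by (simp add: divided_power_def)
qed

text \<open>Expanding the bracket of the exponentials gives one term for each family \<open>k\<close> of exponents below
  \<open>K\<close>. Collecting the terms with a fixed sum of exponents yields the Leibniz rule.\<close>

lemma bracket_exp_shift:
  assumes x: "\<And>i. i < n \<Longrightarrow> x i \<in> gen_eigenspace (l i)"
  shows "bracket (\<lambda>i. exp_shift s (l i) (x i)) = exp_shift s (\<Sum>i<n. l i) (bracket x)"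
proof -
  let ?l = "\<Sum>i<n. l i" and ?P = "{..<n} \<rightarrow>\<^sub>E {..<K}"
  let ?h = "\<lambda>k. bracket (\<lambda>i. divided_power (l i) (k i) (x i))"
  have xA: "x i \<in> A" if "i < n" for i
    using x that gen_eigenspace_in_A by blast
  have finP: "finite ?P"
    by (intro finite_PiE) auto
  have degP: "(\<Sum>i<n. k i) < n * K" if "k \<in> ?P" for k
  proof -
    have "(\<Sum>i<n. k i) < (\<Sum>i<n. K)"
      using n_ge_2 that by (intro sum_strict_mono) (auto simp: lessThan_empty_iff)
    then show ?thesis by simp
  qed
  have "bracket (\<lambda>i. exp_shift s (l i) (x i))
      = (\<Sum>k\<in>?P. bracket (\<lambda>i. s ^ k i *s divided_power (l i) (k i) (x i)))"
    unfolding exp_shift_def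
    by (intro bracket_sum_all subspace_scale subspace_A divided_power_closed xA) auto
  also have "\<dots> = (\<Sum>k\<in>?P. s ^ (\<Sum>i<n. k i) *s ?h k)"
    by (intro sum.cong refl) (simp add: bracket_scale_all divided_power_closed xA power_sum)
  also have "\<dots> = (\<Sum>m<n * K. \<Sum>k\<in>{k \<in> ?P. (\<Sum>i<n. k i) = m}. s ^ (\<Sum>i<n. k i) *s ?h k)"
    using degP by (intro sum.group[symmetric] finP) auto
  also have "\<dots> = (\<Sum>m<n * K. s ^ m *s divided_power ?l m (bracket x))"
  proof (rule sum.cong[OF refl])
    fix m
    have "(\<Sum>k\<in>{k \<in> ?P. (\<Sum>i<n. k i) = m}. ?h k) = (\<Sum>k\<in>multidegrees m. ?h k)"
    proof (rule sum.mono_neutral_left[OF finite_multidegrees])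
      show "{k \<in> ?P. (\<Sum>i<n. k i) = m} \<subseteq> multidegrees m"
        by (auto simp: multidegrees_def PiE_def)
      show "\<forall>k\<in>multidegrees m - {k \<in> ?P. (\<Sum>i<n. k i) = m}. ?h k = 0"
      proof
        fix k assume "k \<in> multidegrees m - {k \<in> ?P. (\<Sum>i<n. k i) = m}"
        then obtain i where "i < n" "K \<le> k i"
          by (auto simp: multidegrees_def PiE_def Pi_def not_less)
        then show "?h k = 0"
          using xA x by (intro bracket_eq_0[of _ i] divided_power_closed divided_power_eq_0) auto
      qed
    qed
    then show "(\<Sum>k\<in>{k \<in> ?P. (\<Sum>i<n. k i) = m}. s ^ (\<Sum>i<n. k i) *s ?h k)
        = s ^ m *s divided_power ?l m (bracket x)"
      by (simp add: divided_power_bracket[OF xA] flip: scale_sum_right)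
  qed
  (* The degrees between K and n * K contribute nothing, since the bracket lies in a generalised
     eigenspace, where K is a nilpotency index as well. *)
  also have "\<dots> = exp_shift s ?l (bracket x)"
    unfolding exp_shift_def
    using n_ge_2 divided_power_eq_0[OF bracket_gen_eigenspace[OF x]]
    by (intro sum.mono_neutral_right) auto
  finally show ?thesis .
qed

definition component :: "'v \<Rightarrow> 'f \<Rightarrow> 'v" where
  "component x = (SOME g. (\<forall>l. g l \<in> gen_eigenspace l) \<and> x = (\<Sum>l\<in>L. g l))"

lemma component:
  assumes "x \<in> A"
  shows "component x l \<in> gen_eigenspace l" and "(\<Sum>l\<in>L. component x l) = x"
  using someI_ex[OF decomposition[OF assms]] by (simp_all add: component_def)

lemma component_sum_eq:
  assumes g: "\<And>l. g l \<in> gen_eigenspace l"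
  shows "component (\<Sum>l\<in>L. g l) l = g l"
proof -
  let ?x = "\<Sum>l\<in>L. g l"
  have x: "?x \<in> A"
    using g gen_eigenspace_in_A by (intro subspace_sum subspace_A) auto
  show ?thesis
  proof (cases "l \<in> L")
    case True
    have "(\<Sum>l\<in>L. component ?x l - g l) = 0"
      using component(2)[OF x] by (simp add: sum_subtractf)
    then have "component ?x l - g l = 0"
      using component(1)[OF x] g True
      by (intro gen_eigenspaces_independent[OF finite_L, of "\<lambda>l. component ?x l - g l"])
        (auto intro: subspace_diff subspace_gen_eigenspace)
    then show ?thesis by simp
  next
    case False
    with component(1)[OF x] g show ?thesis
      using gen_eigenspace_trivial by metis
  qed
qed

lemma component_gen_eigenspace:
  assumes "x \<in> gen_eigenspace m" "m \<in> L"
  shows "component x l = (if l = m then x else 0)"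
proof -
  have "component (\<Sum>l\<in>L. if l = m then x else 0) l = (if l = m then x else 0)"
    by (intro component_sum_eq) (use assms(1) subspace_0[OF subspace_gen_eigenspace] in auto)
  also have "(\<Sum>l\<in>L. if l = m then x else 0) = x"
    using assms(2) finite_L by simp
  finally show ?thesis .
qed

lemma component_add:
  assumes "x \<in> A" "y \<in> A"
  shows "component (x + y) l = component x l + component y l"
proof -
  have "component (\<Sum>l\<in>L. component x l + component y l) l = component x l + component y l"
    by (intro component_sum_eq subspace_add subspace_gen_eigenspace component(1) assms)
  then show ?thesis
    unfolding sum.distrib component(2)[OF assms(1)] component(2)[OF assms(2)] .
qed

lemma component_scale:
  assumes "x \<in> A"
  shows "component (c *s x) l = c *s component x l"
proof -
  have "component (\<Sum>l\<in>L. c *s component x l) l = c *s component x l"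
    by (intro component_sum_eq subspace_scale subspace_gen_eigenspace component(1) assms)
  then show ?thesis
    unfolding scale_sum_right[symmetric] component(2)[OF assms] .
qed

text \<open>This is the product of the semisimple map that acts by \<open>\<chi> l\<close> on \<open>gen_eigenspace l\<close> and the
  exponential of \<open>s\<close> times the nilpotent part of \<open>T\<close>. It respects the bracket as soon as \<open>\<chi>\<close> turns
  sums of weights into products.\<close>

definition twisted_exp :: "('f \<Rightarrow> 'f) \<Rightarrow> 'f \<Rightarrow> 'v \<Rightarrow> 'v" where
  "twisted_exp \<chi> s x = (\<Sum>l\<in>L. \<chi> l *s exp_shift s l (component x l))"

lemma twisted_exp_closed: "x \<in> A \<Longrightarrow> twisted_exp \<chi> s x \<in> A"
  unfolding twisted_exp_def
  using gen_eigenspace_in_A[OF exp_shift_gen_eigenspace[OF component(1)]]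
  by (intro subspace_sum subspace_scale subspace_A)

lemma twisted_exp_add:
  "x \<in> A \<Longrightarrow> y \<in> A \<Longrightarrow> twisted_exp \<chi> s (x + y) = twisted_exp \<chi> s x + twisted_exp \<chi> s y"
  by (simp add: twisted_exp_def component_add exp_shift_add scale_right_distrib sum.distrib)

lemma twisted_exp_scale: "x \<in> A \<Longrightarrow> twisted_exp \<chi> s (c *s x) = c *s twisted_exp \<chi> s x"
  by (simp add: twisted_exp_def component_scale exp_shift_scale scale_sum_right mult.commute)

lemma twisted_exp_zero: "twisted_exp \<chi> s 0 = 0"
  using twisted_exp_scale[of 0 \<chi> s 0] subspace_0[OF subspace_A] by simp

lemma twisted_exp_sum:
  assumes "\<And>i. i \<in> S \<Longrightarrow> f i \<in> A"
  shows "twisted_exp \<chi> s (\<Sum>i\<in>S. f i) = (\<Sum>i\<in>S. twisted_exp \<chi> s (f i))"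
  using assms
  by (induction S rule: infinite_finite_induct)
    (simp_all add: twisted_exp_zero twisted_exp_add subspace_sum subspace_A)

lemma twisted_exp_gen_eigenspace:
  assumes "x \<in> gen_eigenspace l"
  shows "twisted_exp \<chi> s x = \<chi> l *s exp_shift s l x"
proof (cases "l \<in> L")
  case True
  have "twisted_exp \<chi> s x = (\<Sum>m\<in>L. if m = l then \<chi> l *s exp_shift s l x else 0)"
    unfolding twisted_exp_def component_gen_eigenspace[OF assms True]
    by (intro sum.cong) (auto simp: exp_shift_zero)
  with True finite_L show ?thesis
    by simp
next
  case False
  then show ?thesis
    using gen_eigenspace_trivial[OF assms] by (simp add: twisted_exp_zero exp_shift_zero)
qed

lemma bracket_twisted_exp:
  assumes \<chi>: "\<And>l. (\<And>i. i < n \<Longrightarrow> l i \<in> L) \<Longrightarrow> \<chi> (\<Sum>i<n. l i) = (\<Prod>i<n. \<chi> (l i))"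
    and x: "\<And>i. i < n \<Longrightarrow> x i \<in> A"
  shows "bracket (\<lambda>i. twisted_exp \<chi> s (x i)) = twisted_exp \<chi> s (bracket x)"
proof -
  let ?P = "{..<n} \<rightarrow>\<^sub>E L"
  have comp: "component (x i) l \<in> gen_eigenspace l" if "i < n" for i l
    using component(1) x that by blast
  have "bracket x = bracket (\<lambda>i. \<Sum>l\<in>L. component (x i) l)"
    by (intro bracket_cong) (simp add: component x)
  also have "\<dots> = (\<Sum>k\<in>?P. bracket (\<lambda>i. component (x i) (k i)))"
    using comp gen_eigenspace_in_A by (intro bracket_sum_all finite_L) blast
  finally have "twisted_exp \<chi> s (bracket x)
      = (\<Sum>k\<in>?P. twisted_exp \<chi> s (bracket (\<lambda>i. component (x i) (k i))))"
    by (simp add: twisted_exp_sum bracket_closed gen_eigenspace_in_A[OF comp])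
  also have "\<dots> = (\<Sum>k\<in>?P. bracket (\<lambda>i. \<chi> (k i) *s exp_shift s (k i) (component (x i) (k i))))"
  proof (rule sum.cong[OF refl])
    fix k assume k: "k \<in> ?P"
    have "twisted_exp \<chi> s (bracket (\<lambda>i. component (x i) (k i)))
        = \<chi> (\<Sum>i<n. k i) *s exp_shift s (\<Sum>i<n. k i) (bracket (\<lambda>i. component (x i) (k i)))"
      by (intro twisted_exp_gen_eigenspace bracket_gen_eigenspace comp)
    also have "\<dots> = (\<Prod>i<n. \<chi> (k i)) *s bracket (\<lambda>i. exp_shift s (k i) (component (x i) (k i)))"
      using k comp by (subst \<chi>) (auto simp: bracket_exp_shift)
    also have "\<dots> = bracket (\<lambda>i. \<chi> (k i) *s exp_shift s (k i) (component (x i) (k i)))"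
      using comp by (intro bracket_scale_all[symmetric] gen_eigenspace_in_A[OF exp_shift_gen_eigenspace])
    finally show "twisted_exp \<chi> s (bracket (\<lambda>i. component (x i) (k i)))
        = bracket (\<lambda>i. \<chi> (k i) *s exp_shift s (k i) (component (x i) (k i)))" .
  qed
  also have "\<dots> = bracket (\<lambda>i. \<Sum>l\<in>L. \<chi> l *s exp_shift s l (component (x i) l))"
    using comp
    by (intro bracket_sum_all[symmetric] finite_L subspace_scale subspace_A
        gen_eigenspace_in_A[OF exp_shift_gen_eigenspace])
  finally show ?thesis
    by (simp add: twisted_exp_def)
qed

text \<open>On \<open>gen_eigenspace l\<close> the map is \<open>\<chi> l\<close> times a unipotent one: a preimage of \<open>x\<close> is \<open>x\<close> itself
  up to the scalar and to terms of smaller nilpotency index.\<close>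

lemma twisted_exp_surj:
  assumes \<chi>: "\<And>l. \<chi> l \<noteq> 0"
  shows "A \<subseteq> twisted_exp \<chi> s ` A"
proof
  let ?R = "twisted_exp \<chi> s ` A"
  have R: "subspace ?R"
  proof (rule subspaceI)
    show "0 \<in> ?R"
      using twisted_exp_zero[of \<chi> s] subspace_0[OF subspace_A] by force
    show "x + y \<in> ?R" if "x \<in> ?R" "y \<in> ?R" for x y
      using that subspace_add[OF subspace_A] by (auto simp flip: twisted_exp_add)
    show "c *s x \<in> ?R" if "x \<in> ?R" for c x
      using that subspace_scale[OF subspace_A] by (auto simp flip: twisted_exp_scale)
  qed
  have gen: "x \<in> ?R" if "x \<in> gen_eigenspace l" "(shift l ^^ k) x = 0" for x l k
    using that
  proof (induction k arbitrary: x)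
    case 0
    then show ?case
      using subspace_0[OF R] by simp
  next
    case (Suc k)
    have "twisted_exp \<chi> s (inverse (\<chi> l) *s x) = exp_shift s l x"
      using Suc.prems \<chi>[of l] gen_eigenspace_in_A
      by (simp add: twisted_exp_scale twisted_exp_gen_eigenspace)
    then have "exp_shift s l x \<in> ?R"
      using Suc.prems gen_eigenspace_in_A subspace_scale[OF subspace_A] by (metis image_eqI)
    moreover have "(\<Sum>j\<in>{1..<K}. s ^ j *s divided_power l j x) \<in> ?R"
    proof (intro subspace_sum subspace_scale R Suc.IH divided_power_gen_eigenspace Suc.prems)
      fix j assume "j \<in> {1..<K}"
      then have "(shift l ^^ (k + j)) x = 0"
        using shift_pow_eq_0_mono[OF Suc.prems(2)] by simp
      then show "(shift l ^^ k) (divided_power l j x) = 0"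
        by (simp add: divided_power_def shift_pow_scale funpow_add)
    qed
    moreover have "exp_shift s l x = x + (\<Sum>j\<in>{1..<K}. s ^ j *s divided_power l j x)"
      using K_ge_2 unfolding exp_shift_def lessThan_atLeast0
      by (subst sum.atLeast_Suc_lessThan) (auto simp: divided_power_0)
    ultimately show ?case
      using subspace_diff[OF R] by (metis add_diff_cancel_right')
  qed
  fix x assume x: "x \<in> A"
  have "(\<Sum>l\<in>L. component x l) \<in> ?R"
    by (intro subspace_sum R gen[OF component(1)[OF x] shift_pow_K[OF component(1)[OF x]]])
  then show "x \<in> ?R"
    by (simp add: component x)
qed

text \<open>Along the family \<open>\<chi> l = 2 ^ (t * K * h l)\<close>, \<open>s = 2 ^ t\<close> the element \<open>divided_power l j (component x l)\<close>
  appears with coefficient \<open>(2 ^ (K * h l + j)) ^ t\<close>. The exponents \<open>K * h l + j\<close> with \<open>j < K\<close> are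
  distinct, so the Vandermonde argument separates these elements. The eigenvalue part of \<open>T\<close> is
  the case \<open>j = 0\<close>, its nilpotent part the case \<open>j = 1\<close>.\<close>

lemma T_preserves_invariant_subspace:
  assumes W: "subspace W" "W \<subseteq> A"
    and inv: "\<And>\<chi> s x. \<lbrakk>\<And>l. (\<And>i. i < n \<Longrightarrow> l i \<in> L) \<Longrightarrow> \<chi> (\<Sum>i<n. l i) = (\<Prod>i<n. \<chi> (l i));
        \<And>l. \<chi> l \<noteq> 0; x \<in> W\<rbrakk> \<Longrightarrow> twisted_exp \<chi> s x \<in> W"
    and x: "x \<in> W"
  shows "T x \<in> W"
proof -
  obtain h :: "'f \<Rightarrow> int" where h: "inj_on h L"
    "\<And>l (m::nat). (\<And>i. i < m \<Longrightarrow> l i \<in> L) \<Longrightarrow> h (\<Sum>i<m. l i) = (\<Sum>i<m. h (l i))"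
    using ex_additive_int_inj_on[OF finite_L] by metis
  define c where "c = (\<lambda>(l, j). (2::'f) powi (int K * h l + int j))"
  let ?v = "\<lambda>(l, j). divided_power l j (component x l)"
  have inj: "inj_on c (L \<times> {..<K})"
  proof (rule inj_onI)
    fix p q assume "p \<in> L \<times> {..<K}" "q \<in> L \<times> {..<K}" "c p = c q"
    moreover obtain l j l' j' where pq: "p = (l, j)" "q = (l', j')"
      by fastforce
    ultimately have *: "l \<in> L" "j < K" "l' \<in> L" "j' < K" "c (l, j) = c (l', j')"
      by auto
    then have "(2::'f) powi (int K * h l + int j) = 2 powi (int K * h l' + int j')"
      by (simp add: c_def)
    then have eq: "int K * h l + int j = int K * h l' + int j'"
      by (rule two_powi_inject)
    have "h l = (int K * h l + int j) div int K"
      using * by simp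
    also have "\<dots> = h l'"
      unfolding eq using * by simp
    finally have "h l = h l'" .
    with eq h(1) * show "p = q"
      by (simp add: pq inj_onD)
  qed
  have sums: "(\<Sum>p\<in>L \<times> {..<K}. c p ^ t *s ?v p) \<in> W" for t
  proof -
    let ?\<chi> = "\<lambda>l. ((2::'f) powi (int K * h l)) ^ t"
    have pow: "((2::'f) powi (int K * (\<Sum>i<m. h (l i)))) ^ t = (\<Prod>i<m. ?\<chi> (l i))" for l and m :: nat
      by (induction m) (simp_all add: distrib_left power_int_add power_mult_distrib)
    have "twisted_exp ?\<chi> (2 ^ t) x \<in> W"
    proof (intro inv x)
      show "?\<chi> (\<Sum>i<n. l i) = (\<Prod>i<n. ?\<chi> (l i))" if "\<And>i. i < n \<Longrightarrow> l i \<in> L" for l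
        by (subst h(2)[OF that], assumption, rule pow)
    qed simp
    also have "twisted_exp ?\<chi> (2 ^ t) x = (\<Sum>l\<in>L. \<Sum>j<K. c (l, j) ^ t *s ?v (l, j))"
      unfolding twisted_exp_def exp_shift_def scale_sum_right
      by (intro sum.cong refl)
        (simp add: c_def power_int_add power_mult_distrib mult.commute flip: power_mult)
    also have "\<dots> = (\<Sum>p\<in>L \<times> {..<K}. c p ^ t *s ?v p)"
      by (simp add: sum.cartesian_product case_prod_unfold)
    finally show ?thesis .
  qed
  have part: "divided_power l j (component x l) \<in> W" if "l \<in> L" "j < K" for l j
    using power_sums_in_subspaceD[OF W(1) _ inj sums, of "(l, j)"] finite_L that by simp
  have "T x = T (\<Sum>l\<in>L. component x l)"
    using component(2) x W(2) by (metis subsetD)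
  also have "\<dots> = shift 0 (\<Sum>l\<in>L. component x l)"
    by (simp add: shift_def)
  also have "\<dots> = (\<Sum>l\<in>L. shift l (component x l) + l *s component x l)"
    unfolding shift_sum by (simp add: shift_def)
  also have "\<dots> \<in> W"
    using part[of _ 0] part[of _ 1] K_ge_2
    by (intro subspace_sum subspace_add subspace_scale W(1)) (simp_all add: divided_power_0 divided_power_1)
  finally show ?thesis .
qed

end

section \<open>The Frattini subalgebra is an ideal\<close>

context n_Lie_algebra
begin

text \<open>The preimage of a maximal subalgebra under a surjective endomorphism is again maximal: a
  subalgebra above the preimage contains the kernel, so it is determined by its image.\<close>

lemma Frattini_subalgebra_invariant:
  assumes closed: "\<And>x. x \<in> A \<Longrightarrow> f x \<in> A"
    and add: "\<And>x y. x \<in> A \<Longrightarrow> y \<in> A \<Longrightarrow> f (x + y) = f x + f y"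
    and scl: "\<And>c x. x \<in> A \<Longrightarrow> f (scale c x) = scale c (f x)"
    and hom: "\<And>xs. length xs = n \<Longrightarrow> set xs \<subseteq> A \<Longrightarrow> f (br xs) = br (map f xs)"
    and surj: "A \<subseteq> f ` A"
    and x: "x \<in> Frattini_subalgebra"
  shows "f x \<in> Frattini_subalgebra"
  unfolding Frattini_subalgebra_def
proof (intro IntI InterI, goal_cases)
  case 1
  show ?case
    using x closed by (auto simp: Frattini_subalgebra_def)
next
  case (2 M)
  then have M: "subspace M" "M \<subseteq> A" "\<And>xs. length xs = n \<Longrightarrow> set xs \<subseteq> M \<Longrightarrow> br xs \<in> M" "M \<noteq> A"
    and max: "\<And>B. subalgebra B \<Longrightarrow> M \<subset> B \<Longrightarrow> B = A"
    by (auto simp: maximal_subalgebra_def subalgebra_def)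
  have f0: "f 0 = 0"
    using scl[of 0 0] subspace_0[OF subspace_carrier] by simp
  have diff: "f (a - b) = f a - f b" if "a \<in> A" "b \<in> A" for a b
    using add[of "a - b" b] that subspace_diff[OF subspace_carrier] by simp
  define N where "N = {y \<in> A. f y \<in> M}"
  have "subspace N"
    unfolding N_def
    by (rule subspaceI)
      (auto simp: f0 add scl subspace_0 subspace_add subspace_scale subspace_carrier M(1))
  moreover have "br xs \<in> N" if "length xs = n" "set xs \<subseteq> N" for xs
  proof -
    have "set xs \<subseteq> A" "set (map f xs) \<subseteq> M"
      using that by (auto simp: N_def)
    with that show ?thesis
      by (simp add: N_def hom M(3) br_closed)
  qed
  ultimately have "subalgebra N"
    by (auto simp: subalgebra_def N_def)
  moreover have "N \<noteq> A"
  proof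
    assume "N = A"
    then have "A \<subseteq> M"
      using surj by (auto simp: N_def)
    with M(2,4) show False by blast
  qed
  moreover have "B = A" if B: "subalgebra B" "N \<subset> B" for B
  proof -
    have BA: "subspace B" "B \<subseteq> A" "\<And>xs. length xs = n \<Longrightarrow> set xs \<subseteq> B \<Longrightarrow> br xs \<in> B"
      using B(1) by (auto simp: subalgebra_def)
    have "subspace (f ` B)"
    proof (rule subspaceI)
      show "0 \<in> f ` B"
        using f0 subspace_0[OF BA(1)] by force
      show "a + b \<in> f ` B" if ab: "a \<in> f ` B" "b \<in> f ` B" for a b
      proof -
        obtain a' b' where "a = f a'" "b = f b'" "a' \<in> B" "b' \<in> B"
          using ab by blast
        then show ?thesis
          using add[of a' b'] subspace_add[OF BA(1), of a' b'] BA(2) by (metis imageI subsetD)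
      qed
      show "scale c a \<in> f ` B" if a: "a \<in> f ` B" for c a
      proof -
        obtain a' where "a = f a'" "a' \<in> B"
          using a by blast
        then show ?thesis
          using scl[of a' c] subspace_scale[OF BA(1), of a' c] BA(2) by (metis imageI subsetD)
      qed
    qed
    moreover have "br ys \<in> f ` B" if ys: "length ys = n" "set ys \<subseteq> f ` B" for ys
    proof -
      have "ys \<in> lists (f ` B)"
        using ys(2) by auto
      then obtain xs where xs: "ys = map f xs" "set xs \<subseteq> B"
        unfolding lists_image by auto
      have "br ys = f (br xs)"
        using xs ys(1) BA(2) by (simp add: hom)
      moreover have "br xs \<in> B"
        using BA(3)[of xs] xs ys(1) by simp
      ultimately show ?thesis
        by (rule image_eqI)
    qed
    ultimately have "subalgebra (f ` B)"
      using BA(2) closed by (auto simp: subalgebra_def)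
    moreover have "M \<subseteq> f ` B"
    proof
      fix y assume y: "y \<in> M"
      then obtain a where "a \<in> A" "y = f a"
        using M(2) surj by blast
      with y B(2) show "y \<in> f ` B"
        by (auto simp: N_def)
    qed
    moreover have "f ` B \<noteq> M"
      using B(2) BA(2) by (auto simp: N_def)
    ultimately have "f ` B = A"
      using max by blast
    have "a \<in> B" if a: "a \<in> A" for a
    proof -
      obtain b where b: "b \<in> B" "f a = f b"
        using a closed \<open>f ` B = A\<close> by (metis imageE)
      then have "a - b \<in> N"
        using a BA(2) diff[of a b] M(1) subspace_0 subspace_diff[OF subspace_carrier]
        by (auto simp: N_def)
      then have "(a - b) + b \<in> B"
        using B(2) b(1) by (intro subspace_add[OF BA(1)]) auto
      then show ?thesis by simp
    qed
    with BA(2) show ?thesis by blast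
  qed
  ultimately have "maximal_subalgebra N"
    by (auto simp: maximal_subalgebra_def)
  with x show ?case
    by (auto simp: Frattini_subalgebra_def N_def)
qed

end

context n_Lie_derivation_decomposed
begin

lemma T_Frattini_subalgebra: "x \<in> Frattini_subalgebra \<Longrightarrow> T x \<in> Frattini_subalgebra"
proof (rule T_preserves_invariant_subspace[OF subspace_Frattini_subalgebra])
  show "Frattini_subalgebra \<subseteq> A"
    by (auto simp: Frattini_subalgebra_def)
next
  fix \<chi> :: "'f \<Rightarrow> 'f" and s x
  assume \<chi>: "\<And>l. (\<And>i. i < n \<Longrightarrow> l i \<in> L) \<Longrightarrow> \<chi> (\<Sum>i<n. l i) = (\<Prod>i<n. \<chi> (l i))" "\<And>l. \<chi> l \<noteq> 0"
    and x: "x \<in> Frattini_subalgebra"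
  show "twisted_exp \<chi> s x \<in> Frattini_subalgebra"
  proof (rule Frattini_subalgebra_invariant[OF _ _ _ _ _ x])
    fix xs assume xs: "length xs = n" "set xs \<subseteq> A"
    then have "bracket (\<lambda>i. twisted_exp \<chi> s (xs ! i)) = twisted_exp \<chi> s (bracket ((!) xs))"
      by (intro bracket_twisted_exp \<chi>) auto
    moreover have "bracket (\<lambda>i. twisted_exp \<chi> s (xs ! i)) = bracket ((!) (map (twisted_exp \<chi> s) xs))"
      using xs by (intro bracket_cong) simp
    ultimately show "twisted_exp \<chi> s (br xs) = br (map (twisted_exp \<chi> s) xs)"
      using xs by (simp add: bracket_nth)
  qed (use \<chi>(2) in \<open>simp_all add: twisted_exp_closed twisted_exp_add twisted_exp_scale twisted_exp_surj\<close>)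
qed

end

text \<open>An ideal is a subspace preserved by the derivations \<open>x \<mapsto> [x, y\<^sub>2, \<dots>, y\<^sub>n]\<close>, where the derivation
  property is the Jacobi identity.\<close>

lemma ideal_Frattini_subalgebra:
  fixes scale :: "'f::{alg_closed_field, field_char_0} \<Rightarrow> 'v::ab_group_add \<Rightarrow> 'v"
  assumes "n_Lie_algebra scale n br A" and fin: "n_Lie_algebra.finite_dim scale A"
  shows "n_Lie_algebra.ideal scale n br A (n_Lie_algebra.Frattini_subalgebra scale n br A)"
proof -
  interpret n_Lie_algebra scale n br A by fact
  have "br (x # ys) \<in> Frattini_subalgebra"
    if x: "x \<in> Frattini_subalgebra" and ys: "length ys = n - 1" "set ys \<subseteq> A" for x ys
  proof -
    have 0: "0 \<in> A"
      by (rule subspace_0[OF subspace_carrier])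
    have len: "length (0 # ys) = n" "set (0 # ys) \<subseteq> A" "0 < n"
      using ys n_ge_2 0 by auto
    have add: "br ((a + b) # ys) = br (a # ys) + br (b # ys)" if "a \<in> A" "b \<in> A" for a b
      using br_add[OF len that] by simp
    have scl: "br (scale c a # ys) = scale c (br (a # ys))" if "a \<in> A" for a c
      using br_scale[OF len that] by simp
    obtain T where T: "Vector_Spaces.linear scale scale T" "\<And>a. a \<in> A \<Longrightarrow> T a = br (a # ys)"
      using linear_extension[OF subspace_carrier add scl] by metis
    have "n_Lie_derivation scale n br A T"
    proof (unfold_locales, goal_cases)
      case 1 show ?case by (rule subspace_carrier)
    next
      case 2 show ?case using fin by (simp add: finite_dim_def)
    next
      case 3 show ?case using T(1) by (simp add: Vector_Spaces.linear_iff)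
    next
      case 4 show ?case using T(1) by (simp add: Vector_Spaces.linear_iff)
    next
      case (5 a)
      then show ?case using ys n_ge_2 by (simp add: T(2) br_closed)
    next
      case (6 a)
      let ?xs = "map a [0..<n]"
      have "bracket a \<in> A"
        by (intro bracket_closed 6)
      then have "T (bracket a) = br (br ?xs # ys)"
        by (simp add: T(2) bracket_def)
      also have "\<dots> = (\<Sum>i<n. br (?xs[i := br ((?xs ! i) # ys)]))"
        using 6 ys by (intro br_Jacobi) auto
      also have "\<dots> = (\<Sum>i<n. bracket (a(i := T (a i))))"
        using 6 by (intro sum.cong refl) (simp add: bracket_upd T(2) del: fun_upd_apply)
      finally show ?case .
    qed
    then interpret D: n_Lie_derivation scale n br A T .
    show ?thesis
    proof (rule D.ex_eigen_decomposition, goal_cases)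
      case (1 L K)
      interpret E: n_Lie_derivation_decomposed scale n br A T L K
        by unfold_locales (fact 1)+
      show ?case
        using E.T_Frattini_subalgebra[OF x] T(2)[of x] x by (simp add: Frattini_subalgebra_def)
    qed
  qed
  then show ?thesis
    using subspace_Frattini_subalgebra by (auto simp: ideal_def Frattini_subalgebra_def)
qed

section \<open>Complements\<close>

context n_Lie_algebra
begin

lemma subalgebra_carrier: "subalgebra A"
  using subspace_carrier br_closed by (auto simp: subalgebra_def)

lemma subalgebra_Int: "subalgebra B \<Longrightarrow> subalgebra C \<Longrightarrow> subalgebra (B \<inter> C)"
  by (auto simp: subalgebra_def subspace_inter)

lemma subalgebra_hull:
  assumes "S \<subseteq> A"
  shows "subalgebra (subalgebra hull S)"
proof -
  have "subspace (subalgebra hull S)"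
    unfolding hull_def by (intro subspace_Inter) (auto simp: subalgebra_def)
  moreover have "subalgebra hull S \<subseteq> A"
    using assms subalgebra_carrier by (rule hull_minimal)
  moreover have "br xs \<in> subalgebra hull S" if "length xs = n" "set xs \<subseteq> subalgebra hull S" for xs
    unfolding hull_def
  proof
    fix B assume B: "B \<in> {B. subalgebra B \<and> S \<subseteq> B}"
    then have "subalgebra hull S \<subseteq> B"
      by (intro hull_minimal) auto
    with that B show "br xs \<in> B"
      by (auto simp: subalgebra_def)
  qed
  ultimately show ?thesis
    by (simp add: subalgebra_def)
qed

lemma subalgebra_trans:
  assumes "subalgebra C" "n_Lie_algebra.subalgebra scale n br C D"
  shows "subalgebra D"
proof -
  interpret C: n_Lie_algebra scale n br C
    by (rule n_Lie_algebra_subalgebra[OF assms(1)])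
  show ?thesis
    using assms by (auto simp: subalgebra_def C.subalgebra_def)
qed

lemma finite_dim_subalgebra:
  assumes fin: "finite_dim" and C: "subalgebra C"
  shows "n_Lie_algebra.finite_dim scale C"
proof -
  interpret C: n_Lie_algebra scale n br C
    by (rule n_Lie_algebra_subalgebra[OF C])
  obtain B where B: "finite B" "span B = A"
    using fin by (auto simp: finite_dim_def)
  obtain D where "finite D" "span D = C"
    by (rule finite_basis_of_subspace[of B C]) (use B C in \<open>auto simp: subalgebra_def\<close>)
  then show ?thesis
    by (auto simp: C.finite_dim_def)
qed

lemma dim_psubset_subalgebra:
  assumes fin: "finite_dim" and "subalgebra C" "subalgebra D" "C \<subset> D"
  shows "dim C < dim D"
proof -
  obtain B where "finite B" "span B = A"
    using fin by (auto simp: finite_dim_def)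
  then show ?thesis
    using dim_psubset[of B D C] assms by (auto simp: subalgebra_def)
qed

lemma maximal_subalgebra_above:
  assumes fin: "finite_dim" and D: "subalgebra D" "D \<noteq> A"
  obtains M where "maximal_subalgebra M" "D \<subseteq> M"
proof -
  let ?P = "\<lambda>M. subalgebra M \<and> D \<subseteq> M \<and> M \<noteq> A"
  have "dim M < dim A" if "?P M" for M
    using that dim_psubset_subalgebra[OF fin _ subalgebra_carrier] by (auto simp: subalgebra_def)
  then obtain M where M: "?P M" "\<And>N. ?P N \<Longrightarrow> dim N \<le> dim M"
    using ex_has_greatest_nat[of ?P D dim "dim A"] D by auto
  have "maximal_subalgebra M"
    unfolding maximal_subalgebra_def
  proof (intro conjI allI impI)
    fix B assume B: "subalgebra B" "M \<subset> B"
    then have "dim M < dim B"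
      using M(1) dim_psubset_subalgebra[OF fin] by blast
    then show "B = A"
      using M B by (meson not_le psubset_imp_subset order.trans)
  qed (use M in auto)
  with M(1) that show ?thesis
    by blast
qed

text \<open>A complement of an ideal inside the Frattini subalgebra cannot be proper, because a maximal
  subalgebra above it would contain both.\<close>

lemma Frattini_ideal_eq_0_if_complemented:
  assumes fin: "finite_dim" and "complemented"
  shows "Frattini_ideal = {0}"
proof -
  have I: "subspace Frattini_ideal" "Frattini_ideal \<subseteq> A"
    "\<And>x ys. x \<in> Frattini_ideal \<Longrightarrow> length ys = n - 1 \<Longrightarrow> set ys \<subseteq> A \<Longrightarrow> br (x # ys) \<in> Frattini_ideal"
    using ideal_Frattini_ideal by (auto simp: ideal_def)
  have "br xs \<in> Frattini_ideal" if "length xs = n" "set xs \<subseteq> Frattini_ideal" for xs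
    using that I n_ge_2 by (cases xs) auto
  then have "subalgebra Frattini_ideal"
    using I by (auto simp: subalgebra_def)
  then obtain C where C: "subalgebra C" "Frattini_ideal \<inter> C = {0}"
    "subalgebra hull (Frattini_ideal \<union> C) = A"
    using assms(2) by (auto simp: complemented_def)
  have "C = A"
  proof (rule ccontr)
    assume "C \<noteq> A"
    then obtain M where M: "maximal_subalgebra M" "C \<subseteq> M"
      using maximal_subalgebra_above[OF fin C(1)] by blast
    moreover have "Frattini_ideal \<subseteq> M"
      using M(1) Frattini_ideal_subset by (auto simp: Frattini_subalgebra_def)
    ultimately have "subalgebra hull (Frattini_ideal \<union> C) \<subseteq> M"
      by (intro hull_minimal) (auto simp: maximal_subalgebra_def)
    with C(3) M(1) show False
      by (auto simp: maximal_subalgebra_def subalgebra_def)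
  qed
  with C(2) I(2) show ?thesis
    by blast
qed

text \<open>A smallest subalgebra \<open>C\<close> that generates \<open>A\<close> together with \<open>B\<close> meets \<open>B\<close> inside the Frattini
  subalgebra of \<open>C\<close>: if a maximal subalgebra \<open>M\<close> of \<open>C\<close> missed an element of \<open>B \<inter> C\<close>, then the
  subalgebra generated by \<open>M\<close> and \<open>B\<close> would contain \<open>C\<close>, hence be all of \<open>A\<close>.\<close>

lemma complemented_if_Frattini_subalgebras_eq_0:
  assumes fin: "finite_dim"
    and F: "\<And>C. subalgebra C \<Longrightarrow> n_Lie_algebra.Frattini_subalgebra scale n br C = {0}"
  shows "complemented"
  unfolding complemented_def
proof (intro allI impI)
  fix B assume B: "subalgebra B"
  then have BA: "B \<subseteq> A"
    by (simp add: subalgebra_def)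
  let ?P = "\<lambda>C. subalgebra C \<and> subalgebra hull (B \<union> C) = A"
  have "?P A"
    using BA subalgebra_carrier by (simp add: Un_absorb1 hull_same)
  then obtain C where C: "subalgebra C" "subalgebra hull (B \<union> C) = A"
    and min: "\<And>D. ?P D \<Longrightarrow> dim C \<le> dim D"
    using ex_has_least_nat[of ?P A dim] by blast
  interpret C: n_Lie_algebra scale n br C
    by (rule n_Lie_algebra_subalgebra[OF C(1)])
  have CA: "C \<subseteq> A"
    using C(1) by (simp add: subalgebra_def)
  have "x \<in> M" if x: "x \<in> B \<inter> C" and M: "C.maximal_subalgebra M" for x M
  proof (rule ccontr)
    assume "x \<notin> M"
    have MC: "C.subalgebra M" "M \<subseteq> C" "M \<noteq> C"
      using M by (auto simp: C.maximal_subalgebra_def C.subalgebra_def)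
    then have MA: "subalgebra M"
      using subalgebra_trans[OF C(1)] by blast
    let ?H = "subalgebra hull (B \<union> M)"
    have H: "subalgebra ?H" "B \<subseteq> ?H" "M \<subseteq> ?H"
      using subalgebra_hull[of "B \<union> M"] BA MC(2) CA hull_subset[of "B \<union> M" subalgebra] by auto
    have "C.subalgebra (?H \<inter> C)"
      using subalgebra_Int[OF H(1) C(1)] by (auto simp: subalgebra_def C.subalgebra_def)
    moreover have "M \<subset> ?H \<inter> C"
      using x H MC(2) \<open>x \<notin> M\<close> by blast
    ultimately have "?H \<inter> C = C"
      using M by (auto simp: C.maximal_subalgebra_def)
    then have "subalgebra hull (B \<union> C) \<subseteq> ?H"
      using H by (intro hull_minimal) auto
    then have "?H = A"
      using C(2) H(1) by (auto simp: subalgebra_def)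
    then have "dim C \<le> dim M"
      using min MA by blast
    moreover have "dim M < dim C"
      using dim_psubset_subalgebra[OF fin MA C(1)] MC by blast
    ultimately show False
      by simp
  qed
  then have "B \<inter> C \<subseteq> C.Frattini_subalgebra"
    by (auto simp: C.Frattini_subalgebra_def)
  then have "B \<inter> C = {0}"
    using F[OF C(1)] B C(1) subspace_0 by (auto simp: subalgebra_def)
  with C show "\<exists>C. subalgebra C \<and> B \<inter> C = {0} \<and> subalgebra hull (B \<union> C) = A"
    by blast
qed

end

theorem theorem3p2:
  fixes scale :: "'f::{alg_closed_field, field_char_0} \<Rightarrow> 'v::ab_group_add \<Rightarrow> 'v"
    and n :: nat
    and br :: "'v list \<Rightarrow> 'v"
    and A :: "'v set"
  assumes "n_Lie_algebra scale n br A"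
    and "n_Lie_algebra.finite_dim scale A"
  shows "n_Lie_algebra.elementary scale n br A \<longleftrightarrow>
    (\<forall>C. n_Lie_algebra.subalgebra scale n br A C \<longrightarrow> n_Lie_algebra.complemented scale n br C)"
proof -
  interpret n_Lie_algebra scale n br A by fact
  have "n_Lie_algebra.complemented scale n br C" if el: elementary and C: "subalgebra C" for C
  proof -
    interpret C: n_Lie_algebra scale n br C
      by (rule n_Lie_algebra_subalgebra[OF C])
    show ?thesis
    proof (rule C.complemented_if_Frattini_subalgebras_eq_0)
      show C.finite_dim
        by (rule finite_dim_subalgebra[OF assms(2) C])
    next
      fix D assume "C.subalgebra D"
      then have D: "subalgebra D"
        by (rule subalgebra_trans[OF C])
      interpret D: n_Lie_algebra scale n br D
        by (rule n_Lie_algebra_subalgebra[OF D])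
      have "D.ideal D.Frattini_subalgebra"
        by (rule ideal_Frattini_subalgebra[OF D.n_Lie_algebra_axioms finite_dim_subalgebra[OF assms(2) D]])
      then have "D.Frattini_subalgebra \<subseteq> D.Frattini_ideal"
        by (rule D.Frattini_ideal_greatest) simp
      also have "D.Frattini_ideal = {0}"
        using el D by (simp add: elementary_def)
      finally show "D.Frattini_subalgebra = {0}"
        using subspace_0[OF D.subspace_Frattini_subalgebra] by blast
    qed
  qed
  moreover have elementary
    if "\<forall>C. subalgebra C \<longrightarrow> n_Lie_algebra.complemented scale n br C"
    unfolding elementary_def
  proof (intro allI impI)
    fix C assume C: "subalgebra C"
    show "n_Lie_algebra.Frattini_ideal scale n br C = {0}"
      using that C
      by (simp add: n_Lie_algebra.Frattini_ideal_eq_0_if_complemented[OF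
          n_Lie_algebra_subalgebra[OF C] finite_dim_subalgebra[OF assms(2) C]])
  qed
  ultimately show ?thesis
    by blast
qed

end
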